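(* Let $K$ be a knot in $\mathbb{S}^3$ and let $G(K)=\langle m_1,\dots,m_n\mid r_1,\dots,r_{n-1}\rangle$ be a Wirtinger presentation of its knot group associated with an $n$-crossing diagram. Then the trace-free slice $S_0(K)$ is isomorphic (as an algebraic set) to the algebraic set of all points $$\big((x_{ij})_{1\le i<j\le n};\ (x_{ijk})_{1\le i<j<k\le n}\big)\in\mathbb{C}^{\binom n2+\binom n3}$$ satisfying the following two families of equations: (F2) $x_{ak}=x_{ij}x_{ai}-x_{aj}$ for all $1\le a\le n$ and all Wirtinger triples $(i,j,k)$; (GH) for all $1\le i_1<i_2<i_3\le n$ and $1\le j_1<j_2<j_3\le n$, $$x_{i_1i_2i_3}\cdot x_{j_1j_2j_3}=\frac12\begin{vmatrix} x_{i_1j_1} & x_{i_1j_2} & x_{i_1j_3} \\ x_{i_2j_1} & x_{i_2j_2} & x_{i_2j_3} \\ x_{i_3j_1} & x_{i_3j_2} & x_{i_3j_3} \end{vmatrix};$$ with the convention $x_{ii}=2$, $x_{ji}=x_{ij}$ and $x_{i_{\sigma(1)}i_{\sigma(2)}i_{\sigma(3)}}=\mathrm{sign}(\sigma)\,x_{i_1i_2i_3}$ for every permutation $\sigma\in\mathfrak{S}_3$.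
   Context: $G(K)=\pi_1(E_K)$ is the knot group ($E_K$ the knot exterior); $m_i$ is the meridian corresponding to the $i$th arc of the diagram. At each of the $n$ crossings, with overarc $i$ and underarcs $j,k$ (labelled so that $j<k$), $(i,j,k)$ is called a Wirtinger triple. A representation $\rho:G(K)\to\mathrm{SL}_2(\mathbb{C})$ is trace-free if $\mathrm{tr}\,\rho(\mu)=0$ for a (hence every) meridian $\mu$. The trace-free slice $S_0(K)$ is the closed algebraic set $$S_0(K)=\{(\mathrm{tr}\,\rho(m_im_j)_{i<j};\ \mathrm{tr}\,\rho(m_im_jm_k)_{i<j<k})\mid \rho \text{ a trace-free representation of } G(K)\}\subset\mathbb{C}^{\binom n2+\binom n3},$$ which is the intersection of the $\mathrm{SL}_2(\mathbb{C})$-character variety of $G(K)$ with $\{\mathrm{tr}\,\rho(m_i)=0 \text{ for all } i\}$. In the isomorphism of the theorem, the coordinates $x_{ij}$ and $x_{ijk}$ correspond to $-\mathrm{tr}\,\rho(m_im_j)$ and $-\mathrm{tr}\,\rho(m_im_jm_k)$ respectively. *)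

theory Defs
  imports
    "HOL-Algebra.Group"
    "HOL-Combinatorics.Orbits"
    "HOL-Analysis.Analysis"
begin

section \<open>Groups given by generators and relators\<close>

text \<open>A letter \<open>(i, True)\<close> stands for the generator \<open>x\<^sub>i\<close>, and \<open>(i, False)\<close> for its inverse.\<close>

type_synonym gword = "(nat \<times> bool) list"

inductive word_eq :: "nat set \<Rightarrow> gword set \<Rightarrow> gword \<Rightarrow> gword \<Rightarrow> bool"
  for X :: "nat set" and R :: "gword set" where
  refl: "w \<in> lists (X \<times> UNIV) \<Longrightarrow> word_eq X R w w"
| sym: "word_eq X R v w \<Longrightarrow> word_eq X R w v"
| trans: "word_eq X R u v \<Longrightarrow> word_eq X R v w \<Longrightarrow> word_eq X R u w"
| cancel: "u \<in> lists (X \<times> UNIV) \<Longrightarrow> v \<in> lists (X \<times> UNIV) \<Longrightarrow> i \<in> X \<Longrightarrow>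
    word_eq X R (u @ [(i, b), (i, \<not> b)] @ v) (u @ v)"
| relator: "u \<in> lists (X \<times> UNIV) \<Longrightarrow> v \<in> lists (X \<times> UNIV) \<Longrightarrow> r \<in> R \<Longrightarrow>
    word_eq X R (u @ r @ v) (u @ v)"

definition eval_word :: "('g, 'c) monoid_scheme \<Rightarrow> (nat \<Rightarrow> 'g) \<Rightarrow> gword \<Rightarrow> 'g" where
  "eval_word G x w =
     foldr (\<lambda>(i, b) g. (if b then x i else inv\<^bsub>G\<^esub> (x i)) \<otimes>\<^bsub>G\<^esub> g) w \<one>\<^bsub>G\<^esub>"

text \<open>\<open>G = \<langle>x\<^sub>i (i \<in> X) | R\<rangle>\<close>: sending the letter \<open>i\<close> to \<open>x i\<close> induces a bijection from
  words modulo \<^const>\<open>word_eq\<close> to \<open>G\<close>.\<close>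

definition presents ::
    "('g, 'c) monoid_scheme \<Rightarrow> nat set \<Rightarrow> (nat \<Rightarrow> 'g) \<Rightarrow> gword set \<Rightarrow> bool" where
  "presents G X x R \<longleftrightarrow>
     x \<in> X \<rightarrow> carrier G \<and> R \<subseteq> lists (X \<times> UNIV) \<and>
     eval_word G x ` lists (X \<times> UNIV) = carrier G \<and>
     (\<forall>v\<in>lists (X \<times> UNIV). \<forall>w\<in>lists (X \<times> UNIV).
        eval_word G x v = eval_word G x w \<longleftrightarrow> word_eq X R v w)"


section \<open>Knots in the 3-sphere, exteriors and knot groups\<close>

definition path_class :: "'a::topological_space set \<Rightarrow> (real \<Rightarrow> 'a) \<Rightarrow> (real \<Rightarrow> 'a) set" where
  "path_class S p = {q. homotopic_paths S p q}"

text \<open>In a product of two classes, the first factor is the one traversed first.\<close>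

definition fundamental_group ::
    "'a::real_normed_vector set \<Rightarrow> 'a \<Rightarrow> (real \<Rightarrow> 'a) set monoid" where
  "fundamental_group S e =
     \<lparr>carrier = {path_class S p | p.
        path p \<and> path_image p \<subseteq> S \<and> pathstart p = e \<and> pathfinish p = e},
      monoid.mult = (\<lambda>A B. {r. \<exists>p\<in>A. \<exists>q\<in>B. homotopic_paths S (p +++ q) r}),
      one = path_class S (linepath e e)\<rparr>"

abbreviation S3 :: "((real^3) \<times> real) set" where
  "S3 \<equiv> sphere 0 1"

abbreviation S1 :: "complex set" where
  "S1 \<equiv> sphere 0 1"

text \<open>A (tame) knot is a subset \<open>K\<close> of the 3-sphere that is the core of an open solid torus
  \<open>h\<close>; by invariance of domain, \<open>h\<close> is an open embedding. The closed tube used for the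
  exterior has radius 1, and \<open>h\<close> is required to be defined beyond that radius so that the boundary
  torus of the exterior is bicollared.\<close>

definition tubular_neighbourhood ::
    "(complex \<times> complex \<Rightarrow> (real^3) \<times> real) \<Rightarrow> ((real^3) \<times> real) set \<Rightarrow> bool" where
  "tubular_neighbourhood h K \<longleftrightarrow>
     continuous_on (S1 \<times> UNIV) h \<and> inj_on h (S1 \<times> UNIV) \<and>
     h ` (S1 \<times> UNIV) \<subseteq> S3 \<and> h ` (S1 \<times> {0}) = K"

definition knot_exterior ::
    "(complex \<times> complex \<Rightarrow> (real^3) \<times> real) \<Rightarrow> ((real^3) \<times> real) set" where
  "knot_exterior h = S3 - h ` (S1 \<times> ball 0 1)"

abbreviation knot_group ::
    "(complex \<times> complex \<Rightarrow> (real^3) \<times> real) \<Rightarrow> (real^3) \<times> real \<Rightarrow>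
     (real \<Rightarrow> (real^3) \<times> real) set monoid" where
  "knot_group h e \<equiv> fundamental_group (knot_exterior h) e"

text \<open>A meridian runs from the base point to the boundary torus, once around the boundary of a
  fibre disc (in either direction), and back along the same path.\<close>

definition meridians ::
    "(complex \<times> complex \<Rightarrow> (real^3) \<times> real) \<Rightarrow> (real^3) \<times> real \<Rightarrow>
     (real \<Rightarrow> (real^3) \<times> real) set set" where
  "meridians h e =
     {path_class (knot_exterior h) (d +++ (\<lambda>t. h (z, cis (s * 2 * pi * t))) +++ reversepath d)
        | d z s. path d \<and> path_image d \<subseteq> knot_exterior h \<and> pathstart d = e \<and>
            z \<in> S1 \<and> pathfinish d = h (z, 1) \<and> (s = 1 \<or> s = -1)}"


section \<open>Knot diagrams\<close>

text \<open>A diagram with crossings \<open>1, \<dots>, n\<close> is recorded by its signed Gauss code: the cyclic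
  sequence of the \<open>2n\<close> passages through crossings met along the (oriented) knot, and the
  signs of the crossings.\<close>

datatype passage = is_Over: Over (crossing: nat) | Under (crossing: nat)

fun opposite :: "passage \<Rightarrow> passage" where
  "opposite (Over c) = Under c"
| "opposite (Under c) = Over c"

record diagram =
  code :: "passage list"
  positive :: "nat \<Rightarrow> bool"

definition position :: "diagram \<Rightarrow> passage \<Rightarrow> nat" where
  "position D p = (THE t. t < length (code D) \<and> code D ! t = p)"

text \<open>Edge \<open>t\<close> of the underlying 4-valent graph leads from passage \<open>t\<close> to
  passage \<open>t + 1\<close>, cyclically. A dart is an edge with a direction: \<open>True\<close> if it is traversed
  along the orientation of the knot. The next dart is obtained by turning left at the crossing
  reached, so that the orbits are the boundary walks of the faces, each lying to the left.\<close>

definition darts :: "diagram \<Rightarrow> (nat \<times> bool) set" where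
  "darts D = {..<length (code D)} \<times> UNIV"

definition next_dart :: "diagram \<Rightarrow> nat \<times> bool \<Rightarrow> nat \<times> bool" where
  "next_dart D = (\<lambda>(t, fwd).
     let N = length (code D);
         p = code D ! (if fwd then Suc t mod N else t);
         u = position D (opposite p);
         fwd' = (fwd = (is_Over p = positive D (crossing p)))
     in (if fwd' then u else (u + N - 1) mod N, fwd'))"

text \<open>The last condition is planarity: the diagram is a connected graph with \<open>n\<close> vertices and
  \<open>2n\<close> edges, so it lies on the sphere iff its number of faces is \<open>n + 2\<close>, by
  Euler's formula.\<close>

definition knot_diagram :: "nat \<Rightarrow> diagram \<Rightarrow> bool" where
  "knot_diagram n D \<longleftrightarrow>
     n \<ge> 1 \<and> distinct (code D) \<and> set (code D) = Over ` {1..n} \<union> Under ` {1..n} \<and>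
     card (orbit (next_dart D) ` darts D) = n + 2"

text \<open>There are as many arcs as crossings; the arc that leaves the underpassage of crossing
  \<open>c\<close> gets the number \<open>c\<close>. As the crossings are numbered arbitrarily, so are the
  arcs. The arc entering passage \<open>t\<close> thus starts at the last underpassage before
  \<open>t\<close>, in the cyclic sense.\<close>

definition arc_into :: "diagram \<Rightarrow> passage \<Rightarrow> nat" where
  "arc_into D p =
     crossing (last (filter (\<lambda>q. \<not> is_Over q) (rotate (position D p) (code D))))"

definition wirtinger_triples :: "nat \<Rightarrow> diagram \<Rightarrow> (nat \<times> nat \<times> nat) set" where
  "wirtinger_triples n D =
     {(arc_into D (Over c), min (arc_into D (Under c)) c, max (arc_into D (Under c)) c)
        | c. c \<in> {1..n}}"

text \<open>The relator is read along a small counterclockwise circle below the crossing, for meridians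
  that pass under their arc from right to left. With overarc \<open>i\<close>, incoming underarc
  \<open>j\<close> and outgoing underarc \<open>k\<close>, it says that
  \<open>m\<^sub>k = m\<^sub>i\<inverse> m\<^sub>j m\<^sub>i\<close> at a positive and
  \<open>m\<^sub>k = m\<^sub>i m\<^sub>j m\<^sub>i\<inverse>\<close> at a negative crossing.\<close>

definition wirtinger_relator :: "diagram \<Rightarrow> nat \<Rightarrow> gword" where
  "wirtinger_relator D c =
     (let i = arc_into D (Over c); j = arc_into D (Under c); k = c
      in if positive D c then [(i, True), (k, True), (i, False), (j, False)]
         else [(i, True), (j, False), (i, False), (k, True)])"


subsection \<open>Diagrams of a given knot\<close>

text \<open>The closed curve \<open>\<gamma>\<close> of period 1 in 3-space is a regularly embedded circle whose
  projection to the first two coordinates has only transverse double points, which, together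
  with the heights (third coordinate) of the strands, give the diagram \<open>D\<close>.\<close>

definition projects_to :: "(real \<Rightarrow> real^3) \<Rightarrow> diagram \<Rightarrow> bool" where
  "projects_to \<gamma> D \<longleftrightarrow>
     (\<exists>\<gamma>' \<tau>.
        (\<forall>t. (\<gamma> has_vector_derivative \<gamma>' t) (at t)) \<and> continuous_on UNIV \<gamma>' \<and>
        (\<forall>t. \<gamma> (t + 1) = \<gamma> t) \<and> inj_on \<gamma> {0..<1} \<and>
        (\<forall>t. (\<gamma>' t $ 1, \<gamma>' t $ 2) \<noteq> (0, 0)) \<and>
        strict_mono_on {..<length (code D)} \<tau> \<and> \<tau> ` {..<length (code D)} \<subseteq> {0..<1} \<and>
        (\<forall>s\<in>{0..<1}. \<forall>t\<in>{0..<1}. s \<noteq> t \<longrightarrow>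
           (\<gamma> s $ 1 = \<gamma> t $ 1 \<and> \<gamma> s $ 2 = \<gamma> t $ 2 \<longleftrightarrow>
            (\<exists>p\<in>set (code D). s = \<tau> (position D p) \<and> t = \<tau> (position D (opposite p))))) \<and>
        (\<forall>c\<in>crossing ` set (code D).
           let s = \<tau> (position D (Over c)); t = \<tau> (position D (Under c));
               w = \<gamma>' s $ 1 * \<gamma>' t $ 2 - \<gamma>' s $ 2 * \<gamma>' t $ 1
           in \<gamma> s $ 3 > \<gamma> t $ 3 \<and> w \<noteq> 0 \<and> (positive D c \<longleftrightarrow> w > 0)))"

definition inverse_stereographic :: "real^3 \<Rightarrow> (real^3) \<times> real" where
  "inverse_stereographic x =
     ((2 / ((norm x)\<^sup>2 + 1)) *\<^sub>R x, ((norm x)\<^sup>2 - 1) / ((norm x)\<^sup>2 + 1))"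

definition ambient_isotopic :: "((real^3) \<times> real) set \<Rightarrow> ((real^3) \<times> real) set \<Rightarrow> bool" where
  "ambient_isotopic A B \<longleftrightarrow>
     (\<exists>\<Phi> :: real \<Rightarrow> (real^3) \<times> real \<Rightarrow> (real^3) \<times> real.
        continuous_on ({0..1} \<times> S3) (\<lambda>(t, x). \<Phi> t x) \<and>
        (\<forall>t\<in>{0..1}. \<exists>\<Psi>. homeomorphism S3 S3 (\<Phi> t) \<Psi>) \<and>
        (\<forall>x\<in>S3. \<Phi> 0 x = x) \<and> \<Phi> 1 ` A = B)"

definition diagram_of :: "diagram \<Rightarrow> ((real^3) \<times> real) set \<Rightarrow> bool" where
  "diagram_of D K \<longleftrightarrow>
     (\<exists>\<gamma>. projects_to \<gamma> D \<and> ambient_isotopic K (inverse_stereographic ` range \<gamma>))"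


section \<open>Algebraic sets\<close>

text \<open>Points of the affine space with coordinates indexed by \<open>I\<close> are the elements of
  \<open>I \<rightarrow>\<^sub>E UNIV\<close>.\<close>

inductive_set polynomial_maps :: "'v set \<Rightarrow> (('v \<Rightarrow> complex) \<Rightarrow> complex) set"
  for I :: "'v set" where
  const: "(\<lambda>x. a) \<in> polynomial_maps I"
| coordinate: "i \<in> I \<Longrightarrow> (\<lambda>x. x i) \<in> polynomial_maps I"
| add: "f \<in> polynomial_maps I \<Longrightarrow> g \<in> polynomial_maps I \<Longrightarrow> (\<lambda>x. f x + g x) \<in> polynomial_maps I"
| mult: "f \<in> polynomial_maps I \<Longrightarrow> g \<in> polynomial_maps I \<Longrightarrow> (\<lambda>x. f x * g x) \<in> polynomial_maps I"

definition algebraic_set :: "'v set \<Rightarrow> ('v \<Rightarrow> complex) set \<Rightarrow> bool" where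
  "algebraic_set I S \<longleftrightarrow>
     (\<exists>F \<subseteq> polynomial_maps I. S = {x \<in> I \<rightarrow>\<^sub>E UNIV. \<forall>f\<in>F. f x = 0})"

definition regular_map ::
    "'v set \<Rightarrow> ('v \<Rightarrow> complex) set \<Rightarrow> 'w set \<Rightarrow> ('w \<Rightarrow> complex) set \<Rightarrow>
     (('v \<Rightarrow> complex) \<Rightarrow> 'w \<Rightarrow> complex) \<Rightarrow> bool" where
  "regular_map I S J T f \<longleftrightarrow>
     f \<in> S \<rightarrow> T \<and> (\<forall>j\<in>J. \<exists>p\<in>polynomial_maps I. \<forall>x\<in>S. f x j = p x)"

definition algebraic_isomorphism ::
    "'v set \<Rightarrow> ('v \<Rightarrow> complex) set \<Rightarrow> 'w set \<Rightarrow> ('w \<Rightarrow> complex) set \<Rightarrow>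
     (('v \<Rightarrow> complex) \<Rightarrow> 'w \<Rightarrow> complex) \<Rightarrow> bool" where
  "algebraic_isomorphism I S J T f \<longleftrightarrow>
     algebraic_set I S \<and> algebraic_set J T \<and> regular_map I S J T f \<and>
     (\<exists>g. regular_map J T I S g \<and> (\<forall>x\<in>S. g (f x) = x) \<and> (\<forall>y\<in>T. f (g y) = y))"


section \<open>The trace-free slice and the equations\<close>

datatype coord = Pair_coord nat nat | Triple_coord nat nat nat

definition coords :: "nat \<Rightarrow> coord set" where
  "coords n = {Pair_coord i j | i j. 1 \<le> i \<and> i < j \<and> j \<le> n} \<union>
              {Triple_coord i j k | i j k. 1 \<le> i \<and> i < j \<and> j < k \<and> k \<le> n}"

definition SL2 :: "(complex^2^2) monoid" where
  "SL2 = \<lparr>carrier = {A. det A = 1}, monoid.mult = (**), one = mat 1\<rparr>"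

definition trace_free ::
    "(complex \<times> complex \<Rightarrow> (real^3) \<times> real) \<Rightarrow> (real^3) \<times> real \<Rightarrow>
     ((real \<Rightarrow> (real^3) \<times> real) set \<Rightarrow> complex^2^2) \<Rightarrow> bool" where
  "trace_free h e \<rho> \<longleftrightarrow> (\<forall>\<mu>\<in>meridians h e. trace (\<rho> \<mu>) = 0)"

definition trace_point ::
    "nat \<Rightarrow> ('g, 'c) monoid_scheme \<Rightarrow> (nat \<Rightarrow> 'g) \<Rightarrow> ('g \<Rightarrow> complex^2^2) \<Rightarrow> coord \<Rightarrow> complex" where
  "trace_point n G m \<rho> = (\<lambda>c\<in>coords n. case c of
       Pair_coord i j \<Rightarrow> trace (\<rho> (m i \<otimes>\<^bsub>G\<^esub> m j))
     | Triple_coord i j k \<Rightarrow> trace (\<rho> (m i \<otimes>\<^bsub>G\<^esub> m j \<otimes>\<^bsub>G\<^esub> m k)))"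

definition trace_free_slice ::
    "(complex \<times> complex \<Rightarrow> (real^3) \<times> real) \<Rightarrow> (real^3) \<times> real \<Rightarrow> nat \<Rightarrow>
     (nat \<Rightarrow> (real \<Rightarrow> (real^3) \<times> real) set) \<Rightarrow> (coord \<Rightarrow> complex) set" where
  "trace_free_slice h e n m =
     {trace_point n (knot_group h e) m \<rho> | \<rho>. \<rho> \<in> hom (knot_group h e) SL2 \<and> trace_free h e \<rho>}"

text \<open>The conventions \<open>x\<^sub>i\<^sub>i = 2\<close> and \<open>x\<^sub>j\<^sub>i = x\<^sub>i\<^sub>j\<close>. Triple coordinates
  occur in the equations only with increasing indices.\<close>

definition pair_val :: "(coord \<Rightarrow> complex) \<Rightarrow> nat \<Rightarrow> nat \<Rightarrow> complex" where
  "pair_val x i j = (if i = j then 2 else x (Pair_coord (min i j) (max i j)))"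

definition F2 :: "nat \<Rightarrow> diagram \<Rightarrow> (coord \<Rightarrow> complex) \<Rightarrow> bool" where
  "F2 n D x \<longleftrightarrow> (\<forall>a\<in>{1..n}. \<forall>(i, j, k)\<in>wirtinger_triples n D.
     pair_val x a k = pair_val x i j * pair_val x a i - pair_val x a j)"

definition GH :: "nat \<Rightarrow> (coord \<Rightarrow> complex) \<Rightarrow> bool" where
  "GH n x \<longleftrightarrow> (\<forall>i1 i2 i3 j1 j2 j3.
     1 \<le> i1 \<and> i1 < i2 \<and> i2 < i3 \<and> i3 \<le> n \<and> 1 \<le> j1 \<and> j1 < j2 \<and> j2 < j3 \<and> j3 \<le> n \<longrightarrow>
     x (Triple_coord i1 i2 i3) * x (Triple_coord j1 j2 j3) =
       1 / 2 * det (vector [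
         vector [pair_val x i1 j1, pair_val x i1 j2, pair_val x i1 j3],
         vector [pair_val x i2 j1, pair_val x i2 j2, pair_val x i2 j3],
         vector [pair_val x i3 j1, pair_val x i3 j2, pair_val x i3 j3]] :: complex^3^3))"

definition F2_GH_set :: "nat \<Rightarrow> diagram \<Rightarrow> (coord \<Rightarrow> complex) set" where
  "F2_GH_set n D = {x \<in> coords n \<rightarrow>\<^sub>E UNIV. F2 n D x \<and> GH n x}"

end

theory Submission
  imports Defs
begin

text \<open>Trace-free matrices of determinant 1 are the vectors of square 2 in the 3-dimensional space of
  trace-free matrices with the form \<open>- tr (A B)\<close>, and conjugation by such a matrix is the half turn
  \<open>v \<mapsto> \<langle>u, v\<rangle> u - v\<close>. So a trace-free representation is a family of vectors \<open>v\<^sub>i\<close> with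
  \<open>v\<^sub>k = \<langle>v\<^sub>i, v\<^sub>j\<rangle> v\<^sub>i - v\<^sub>j\<close> at each crossing; its coordinates are the Gram matrix of the family and
  the volumes of the triples, up to sign. Conversely, (GH) says that the \<open>3 \<times> 3\<close> minors of the matrix
  \<open>(x\<^sub>i\<^sub>j)\<close> form a matrix of rank at most 1, so \<open>(x\<^sub>i\<^sub>j)\<close> has rank at most 3 and is a Gram matrix of
  vectors that span a nondegenerate subspace; by nondegeneracy, (F2) becomes the relation between
  the vectors. The relation at the omitted crossing comes from the planarity of the diagram.\<close>

section \<open>The fundamental group and conjugacy of meridians\<close>

text \<open>Two mismatches shape the proof. The slice demands trace 0 on every meridian of the tube,
  while a point of the algebraic set controls only the generators; so all meridians have to be
  conjugate up to inversion. And (F2) ranges over all n crossings, while the presentation has n - 1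
  relators; the missing one is derived from the face count of the Gauss code. Orientations drop out
  in \<open>SL2\<close>: a trace-free matrix of determinant 1 squares to -1, so conjugation by it
  and by its inverse agree, and the half turn is an involution, so neither the sign of a crossing
  nor the order of its underarcs matters. The factor 1/2 in (GH) comes from the form, whose matrix
  in the coordinates of \<open>sl\<close> has determinant 2. A Gram matrix leaves a common sign of
  the volumes open; replacing every vector by its negative settles it. A nondegenerate span is
  essential, since products with the vectors determine a vector of their span only modulo the
  radical.\<close>

definition loop_at :: "'a::topological_space set \<Rightarrow> 'a \<Rightarrow> (real \<Rightarrow> 'a) \<Rightarrow> bool" where
  "loop_at S e p \<longleftrightarrow> path p \<and> path_image p \<subseteq> S \<and> pathstart p = e \<and> pathfinish p = e"

lemma loop_at_join: "loop_at S e p \<Longrightarrow> loop_at S e q \<Longrightarrow> loop_at S e (p +++ q)"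
  by (auto simp: loop_at_def path_image_join)

lemma path_class_eqI: "homotopic_paths S p q \<Longrightarrow> path_class S p = path_class S q"
  using homotopic_paths_sym homotopic_paths_trans unfolding path_class_def by blast

lemma carrier_fundamental_group:
  "carrier (fundamental_group S e) = path_class S ` {p. loop_at S e p}"
  by (auto simp: fundamental_group_def loop_at_def)

lemma path_class_carrier: "loop_at S e p \<Longrightarrow> path_class S p \<in> carrier (fundamental_group S e)"
  by (auto simp: carrier_fundamental_group)

lemma mult_fundamental_group:
  assumes p: "loop_at S e p" and q: "loop_at S e q"
  shows "path_class S p \<otimes>\<^bsub>fundamental_group S e\<^esub> path_class S q = path_class S (p +++ q)"
proof -
  have "homotopic_paths S (p +++ q) (p' +++ q')"
    if "homotopic_paths S p p'" "homotopic_paths S q q'" for p' q'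
    using that p q by (intro homotopic_paths_join) (auto simp: loop_at_def)
  moreover have "homotopic_paths S p p" "homotopic_paths S q q"
    using p q by (auto simp: loop_at_def)
  ultimately have "{r. \<exists>p'\<in>path_class S p. \<exists>q'\<in>path_class S q. homotopic_paths S (p' +++ q') r}
     = path_class S (p +++ q)"
    unfolding path_class_def by (blast intro: homotopic_paths_trans)
  then show ?thesis by (simp add: fundamental_group_def)
qed

lemma fundamental_group_group:
  assumes "e \<in> S"
  shows "group (fundamental_group S e)"
proof -
  let ?G = "fundamental_group S e"
  have one: "\<one>\<^bsub>?G\<^esub> = path_class S (linepath e e)" by (simp add: fundamental_group_def)
  have l: "loop_at S e (linepath e e)" using assms by (auto simp: loop_at_def)
  show ?thesis
  proof (rule groupI)
    fix x y z assume "x \<in> carrier ?G" "y \<in> carrier ?G" "z \<in> carrier ?G"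
    then obtain p q r where pqr: "loop_at S e p" "loop_at S e q" "loop_at S e r"
      and x: "x = path_class S p" "y = path_class S q" "z = path_class S r"
      by (auto simp: carrier_fundamental_group)
    show "x \<otimes>\<^bsub>?G\<^esub> y \<in> carrier ?G"
      by (simp add: x pqr mult_fundamental_group path_class_carrier loop_at_join)
    have "homotopic_paths S (p +++ (q +++ r)) ((p +++ q) +++ r)"
      using pqr by (intro homotopic_paths_assoc) (auto simp: loop_at_def)
    then show "x \<otimes>\<^bsub>?G\<^esub> y \<otimes>\<^bsub>?G\<^esub> z = x \<otimes>\<^bsub>?G\<^esub> (y \<otimes>\<^bsub>?G\<^esub> z)"
      using path_class_eqI by (fastforce simp: x pqr mult_fundamental_group loop_at_join)
  next
    show "\<one>\<^bsub>?G\<^esub> \<in> carrier ?G" by (simp add: one l path_class_carrier)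
  next
    fix x assume "x \<in> carrier ?G"
    then obtain p where p: "loop_at S e p" and x: "x = path_class S p"
      by (auto simp: carrier_fundamental_group)
    have "homotopic_paths S (linepath e e +++ p) p"
      using p by (intro homotopic_paths_lid') (auto simp: loop_at_def)
    then show "\<one>\<^bsub>?G\<^esub> \<otimes>\<^bsub>?G\<^esub> x = x"
      using path_class_eqI by (fastforce simp: x p l one mult_fundamental_group)
    have r: "loop_at S e (reversepath p)" using p by (simp add: loop_at_def)
    have "homotopic_paths S (reversepath p +++ p) (linepath e e)"
      using homotopic_paths_linv[of p S] p by (simp add: loop_at_def)
    then have "path_class S (reversepath p) \<otimes>\<^bsub>?G\<^esub> x = \<one>\<^bsub>?G\<^esub>"
      using path_class_eqI by (fastforce simp: x p r one mult_fundamental_group)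
    then show "\<exists>y\<in>carrier ?G. y \<otimes>\<^bsub>?G\<^esub> x = \<one>\<^bsub>?G\<^esub>"
      using path_class_carrier[OF r] by blast
  qed
qed

text \<open>The straight-line homotopy in the convex domain, pushed forward by \<open>F\<close>. It
  turns a map on a square into a relation between the images of its sides.\<close>

lemma homotopic_paths_convex_image:
  fixes C :: "'a::real_normed_vector set"
  assumes "convex C" "continuous_on C F" "F \<in> C \<rightarrow> S" "path p" "path q"
    "path_image p \<subseteq> C" "path_image q \<subseteq> C" "pathstart q = pathstart p" "pathfinish q = pathfinish p"
  shows "homotopic_paths S (F \<circ> p) (F \<circ> q)"
proof -
  have "homotopic_paths C p q"
  proof (rule homotopic_paths_linear)
    fix t :: real assume t: "t \<in> {0..1}"
    then show "closed_segment (p t) (q t) \<subseteq> C"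
      using assms(1,6,7) by (intro closed_segment_subset) (auto simp: path_image_def)
  qed (use assms in auto)
  then show ?thesis using assms(2,3) by (rule homotopic_paths_continuous_image)
qed

section \<open>Conjugacy and inversion of meridians\<close>

definition meridian_loop ::
    "(complex \<times> complex \<Rightarrow> (real^3) \<times> real) \<Rightarrow> (real \<Rightarrow> (real^3) \<times> real) \<Rightarrow> complex \<Rightarrow> real \<Rightarrow>
     real \<Rightarrow> (real^3) \<times> real" where
  "meridian_loop h d z s = d +++ (\<lambda>t. h (z, cis (s * 2 * pi * t))) +++ reversepath d"

lemma torus_subset_exterior:
  assumes "tubular_neighbourhood h K" "z \<in> S1" "w \<in> S1"
  shows "h (z, w) \<in> knot_exterior h"
proof -
  have "h (z, w) \<notin> h ` (S1 \<times> ball 0 1)"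
  proof
    assume "h (z, w) \<in> h ` (S1 \<times> ball 0 1)"
    then obtain z' w' where z': "h (z, w) = h (z', w')" "z' \<in> S1" "w' \<in> ball 0 1" by blast
    then have "(z, w) = (z', w')"
      using assms unfolding tubular_neighbourhood_def
      by (metis inj_onD UNIV_I mem_Sigma_iff)
    then show False using z' assms by auto
  qed
  moreover have "h (z, w) \<in> S3"
    using assms unfolding tubular_neighbourhood_def by blast
  ultimately show ?thesis by (auto simp: knot_exterior_def)
qed

text \<open>Two meridian loops with the same orientation are the images of two opposite sides of the square
  \<open>[-1, 2]\<^sup>2\<close> under a continuous map \<open>F\<close> that agrees on the other two sides. On the unit
  square, \<open>F\<close> sweeps the loop along the boundary torus from the fibre over \<open>z1\<close> to the one over
  \<open>z2\<close>; the strip \<open>y \<in> [0, 1]\<close> is projected to the unit square, and the rest to the paths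
  \<open>d1\<close>, \<open>d2\<close> and to the curve of base points on the torus.\<close>

lemma meridian_square:
  assumes h: "tubular_neighbourhood h K"
    and d1: "path d1" "path_image d1 \<subseteq> knot_exterior h" "pathstart d1 = e" "pathfinish d1 = h (z1, 1)"
    and d2: "path d2" "path_image d2 \<subseteq> knot_exterior h" "pathstart d2 = e" "pathfinish d2 = h (z2, 1)"
    and z: "z1 \<in> S1" "z2 \<in> S1" and s: "s = 1 \<or> s = (-1::real)"
  obtains F :: "real \<times> real \<Rightarrow> (real^3) \<times> real" where
    "continuous_on ({-1..2} \<times> {-1..2}) F" "F \<in> {-1..2} \<times> {-1..2} \<rightarrow> knot_exterior h"
    "\<And>t. t \<in> {0..1} \<Longrightarrow> F (-1, t - 1) = d1 t" "\<And>t. t \<in> {0..1} \<Longrightarrow> F (2, t - 1) = d2 t"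
    "\<And>t. t \<in> {0..1} \<Longrightarrow> F (-1, t + 1) = d1 (1 - t)" "\<And>t. t \<in> {0..1} \<Longrightarrow> F (2, t + 1) = d2 (1 - t)"
    "\<And>t. t \<in> {0..1} \<Longrightarrow> F (-1, t) = h (z1, cis (s * 2 * pi * t))"
    "\<And>t. t \<in> {0..1} \<Longrightarrow> F (2, t) = h (z2, cis (s * 2 * pi * t))"
    "\<And>x. F (x, 2) = F (x, -1)"
proof -
  let ?E = "knot_exterior h"
  define \<alpha> \<beta> where "\<alpha> = Arg z1" and "\<beta> = Arg z2"
  have \<alpha>: "cis \<alpha> = z1" and \<beta>: "cis \<beta> = z2"
    using z rcis_cmod_Arg[of z1] rcis_cmod_Arg[of z2] by (auto simp: rcis_def \<alpha>_def \<beta>_def)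
  \<comment> \<open>The clamp keeps \<open>a\<close> constant outside the unit interval, so that
    \<open>L\<close> makes sense on the whole strip.\<close>
  define a where "a x = cis (\<alpha> + min 1 (max 0 x) * (\<beta> - \<alpha>))" for x :: real
  have a: "x \<le> 0 \<Longrightarrow> a x = z1" "1 \<le> x \<Longrightarrow> a x = z2" for x by (simp_all add: a_def \<alpha> \<beta>)
  define L where "L = (\<lambda>(x, y). h (a x, cis (s * 2 * pi * y)))"
  \<comment> \<open>\<open>u\<close> is the distance to the strip. Cutting off with
    \<open>min\<close> makes the pieces agree along \<open>x = 0\<close> and \<open>x = 1\<close>,
    at the ends of the two paths, and still gives \<open>d1\<close> and \<open>d2\<close> reversed
    on the outer sides.\<close>
  define B where "B = (\<lambda>(x, u). if x \<le> 0 then d1 (1 - min (- x) u) else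
     if x \<le> 1 then h (a x, 1) else d2 (1 - min (x - 1) u))"
  define F where "F = (\<lambda>(x, y). if y \<le> 0 then B (x, - y) else
     if y \<le> 1 then L (x, y) else B (x, y - 1))"
  have c1: "cis (s * 2 * pi) = 1" using s by (auto simp: complex_eq_iff)
  have ends: "d1 0 = e" "d1 1 = h (z1, 1)" "d2 0 = e" "d2 1 = h (z2, 1)"
    using d1 d2 by (auto simp: pathstart_def pathfinish_def)
  have torus: "continuous_on (S1 \<times> S1) h" "h \<in> S1 \<times> S1 \<rightarrow> ?E"
    using h torus_subset_exterior[OF h] continuous_on_subset[of "S1 \<times> UNIV" h "S1 \<times> S1"]
    by (auto simp: tubular_neighbourhood_def)
  have aS: "a x \<in> S1" for x by (simp add: a_def)
  have contL: "continuous_on T L" for T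
    unfolding L_def case_prod_unfold a_def
    by (rule continuous_on_compose2[OF torus(1)]) (auto intro!: continuous_intros)
  have pd: "continuous_on {0..1} d1" "continuous_on {0..1} d2" using d1 d2 by (auto simp: path_def)
  have contB: "continuous_on ({-1..2} \<times> {0..1}) B"
    unfolding B_def case_prod_unfold
  proof (intro continuous_on_cases_le)
    show "continuous_on {t \<in> {-1..2} \<times> {0..1}. fst t \<le> 0} (\<lambda>p. d1 (1 - min (- fst p) (snd p)))"
      by (rule continuous_on_compose2[OF pd(1)]) (auto intro!: continuous_intros)
    show "continuous_on {t \<in> {t \<in> {-1..2} \<times> {0..1}. 0 \<le> fst t}. fst t \<le> 1} (\<lambda>p. h (a (fst p), 1))"
      unfolding a_def by (rule continuous_on_compose2[OF torus(1)]) (auto intro!: continuous_intros)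
    show "continuous_on {t \<in> {t \<in> {-1..2} \<times> {0..1}. 0 \<le> fst t}. 1 \<le> fst t}
      (\<lambda>p. d2 (1 - min (fst p - 1) (snd p)))"
      by (rule continuous_on_compose2[OF pd(2)]) (auto intro!: continuous_intros)
  qed (auto intro!: continuous_intros simp: ends a)
  have B0: "B (x, 0) = h (a x, 1)" for x by (auto simp: B_def ends a)
  show ?thesis
  proof
    show "continuous_on ({-1..2} \<times> {-1..2}) F"
      unfolding F_def case_prod_unfold
    proof (intro continuous_on_cases_le)
      show "continuous_on {t \<in> {-1..2} \<times> {-1..2}. snd t \<le> 0} (\<lambda>p. B (fst p, - snd p))"
        by (rule continuous_on_compose2[OF contB]) (auto intro!: continuous_intros)
      show "continuous_on {t \<in> {t \<in> {-1..2} \<times> {-1..2}. 0 \<le> snd t}. snd t \<le> 1} (\<lambda>p. L (fst p, snd p))"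
        by (rule continuous_on_compose2[OF contL[of UNIV]]) (auto intro!: continuous_intros)
      show "continuous_on {t \<in> {t \<in> {-1..2} \<times> {-1..2}. 0 \<le> snd t}. 1 \<le> snd t}
        (\<lambda>p. B (fst p, snd p - 1))"
        by (rule continuous_on_compose2[OF contB]) (auto intro!: continuous_intros)
    qed (auto intro!: continuous_intros simp: B0 L_def c1)
    have "d1 t \<in> ?E" "d2 t \<in> ?E" if "0 \<le> t" "t \<le> 1" for t
      using that d1(2) d2(2) by (auto simp: path_image_def)
    then have "B (x, u) \<in> ?E" if "-1 \<le> x" "x \<le> 2" "0 \<le> u" "u \<le> 1" for x u
      using that torus(2) aS by (auto simp: B_def Pi_iff)
    moreover have "L (x, y) \<in> ?E" for x y
      using torus(2) aS by (auto simp: L_def Pi_iff)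
    ultimately show "F \<in> {-1..2} \<times> {-1..2} \<rightarrow> ?E"
      by (auto simp: F_def)
    show "F (-1, t - 1) = d1 t" "F (2, t - 1) = d2 t" if "t \<in> {0..1}" for t
      using that by (auto simp: F_def B_def)
    show "F (-1, t + 1) = d1 (1 - t)" "F (2, t + 1) = d2 (1 - t)" if "t \<in> {0..1}" for t
      using that by (auto simp: F_def B_def L_def a c1 ends)
    show "F (-1, t) = h (z1, cis (s * 2 * pi * t))"
      "F (2, t) = h (z2, cis (s * 2 * pi * t))" if "t \<in> {0..1}" for t
      using that by (auto simp: F_def B_def L_def a c1 ends)
    show "F (x, 2) = F (x, -1)" for x by (simp add: F_def)
  qed
qed

lemma fibre_loop:
  assumes h: "tubular_neighbourhood h K" and z: "z \<in> S1" and s: "s = 1 \<or> s = (-1::real)"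
  defines "l \<equiv> \<lambda>t. h (z, cis (s * 2 * pi * t))"
  shows "path l" "path_image l \<subseteq> knot_exterior h" "pathstart l = h (z, 1)" "pathfinish l = h (z, 1)"
proof -
  have "continuous_on (S1 \<times> UNIV) h" using h by (simp add: tubular_neighbourhood_def)
  then show "path l" unfolding path_def l_def
    by (rule continuous_on_compose2) (use z in \<open>auto intro!: continuous_intros\<close>)
  show "path_image l \<subseteq> knot_exterior h"
    using torus_subset_exterior[OF h z] by (auto simp: path_image_def l_def)
  have "cis (s * 2 * pi) = 1" using s by (auto simp: complex_eq_iff)
  then show "pathstart l = h (z, 1)" "pathfinish l = h (z, 1)"
    by (auto simp: pathstart_def pathfinish_def l_def)
qed

lemma meridian_loop_is_loop:
  assumes h: "tubular_neighbourhood h K"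
    and d: "path d" "path_image d \<subseteq> knot_exterior h" "pathstart d = e" "pathfinish d = h (z, 1)"
    and z: "z \<in> S1" and s: "s = 1 \<or> s = (-1::real)"
  shows "loop_at (knot_exterior h) e (meridian_loop h d z s)"
  using d fibre_loop[OF h z s] by (auto simp: meridian_loop_def loop_at_def path_image_join)

text \<open>The two ways around the square between opposite corners are homotopic. Its top and
  bottom have the same image, a loop at \<open>e\<close>, and this loop is the conjugator.\<close>

lemma meridian_loops_conjugate:
  assumes h: "tubular_neighbourhood h K"
    and d1: "path d1" "path_image d1 \<subseteq> knot_exterior h" "pathstart d1 = e" "pathfinish d1 = h (z1, 1)"
    and d2: "path d2" "path_image d2 \<subseteq> knot_exterior h" "pathstart d2 = e" "pathfinish d2 = h (z2, 1)"
    and z: "z1 \<in> S1" "z2 \<in> S1" and s: "s = 1 \<or> s = (-1::real)"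
  defines "G \<equiv> knot_group h e"
  shows "\<exists>c\<in>carrier G. path_class (knot_exterior h) (meridian_loop h d1 z1 s) \<otimes>\<^bsub>G\<^esub> c =
     c \<otimes>\<^bsub>G\<^esub> path_class (knot_exterior h) (meridian_loop h d2 z2 s)"
proof -
  let ?E = "knot_exterior h"
  let ?Q = "{-1..2} \<times> {-1..2} :: (real \<times> real) set"
  obtain F where F: "continuous_on ?Q F" "F \<in> ?Q \<rightarrow> ?E"
    and Fd: "\<And>t. t \<in> {0..1} \<Longrightarrow> F (-1, t - 1) = d1 t" "\<And>t. t \<in> {0..1} \<Longrightarrow> F (2, t - 1) = d2 t"
    "\<And>t. t \<in> {0..1} \<Longrightarrow> F (-1, t + 1) = d1 (1 - t)" "\<And>t. t \<in> {0..1} \<Longrightarrow> F (2, t + 1) = d2 (1 - t)"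
    "\<And>t. t \<in> {0..1} \<Longrightarrow> F (-1, t) = h (z1, cis (s * 2 * pi * t))"
    "\<And>t. t \<in> {0..1} \<Longrightarrow> F (2, t) = h (z2, cis (s * 2 * pi * t))"
    and Fc: "\<And>x. F (x, 2) = F (x, -1)"
    by (rule meridian_square[OF h d1 d2 z s]) (rule that; assumption)
  \<comment> \<open>Bracketed as in \<open>meridian_loop\<close>, so that the images of the sides
    agree with the meridian loops pointwise on the unit interval.\<close>
  define side :: "real \<Rightarrow> real \<Rightarrow> real \<times> real" where
    "side x = linepath (x, -1) (x, 0) +++ (linepath (x, 0) (x, 1) +++ linepath (x, 1) (x, 2))" for x
  define row :: "real \<Rightarrow> real \<Rightarrow> real \<times> real" where "row y = linepath (-1, y) (2, y)" for y
  have cv: "convex ?Q" by (intro convex_Times) auto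
  have seg: "closed_segment p q \<subseteq> ?Q" if "p \<in> ?Q" "q \<in> ?Q" for p q
    using that cv by (intro closed_segment_subset) auto
  have side: "path (side x)" "pathstart (side x) = (x, -1)" "pathfinish (side x) = (x, 2)" for x
    by (auto simp: side_def)
  have sideQ: "path_image (side x) \<subseteq> ?Q" if "x \<in> {-1..2}" for x
    using that seg by (simp add: side_def path_image_join)
  have row: "path (row y)" "pathstart (row y) = (-1, y)" "pathfinish (row y) = (2, y)" for y
    by (auto simp: row_def)
  have rowQ: "path_image (row y) \<subseteq> ?Q" if "y \<in> {-1..2}" for y
    using that seg by (simp add: row_def)
  have rows: "F \<circ> row 2 = F \<circ> row (-1)"
    by (rule ext) (simp add: row_def linepath_def algebra_simps Fc)
  have ml1: "(F \<circ> side (-1)) t = meridian_loop h d1 z1 s t"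
    and ml2: "(F \<circ> side 2) t = meridian_loop h d2 z2 s t" if "t \<in> {0..1}" for t
    unfolding side_def meridian_loop_def path_compose_join
    by (rule joinpaths_eq joinpaths_eq[OF _ joinpaths_eq] that
        | simp add: linepath_def algebra_simps Fd reversepath_def)+
  have Fe: "F (-1, -1) = e" "F (2, -1) = e"
    using Fd(1)[of 0] Fd(2)[of 0] d1(3) d2(3) by (auto simp: pathstart_def)
  have loops: "loop_at ?E e (meridian_loop h d1 z1 s)" "loop_at ?E e (meridian_loop h d2 z2 s)"
    using meridian_loop_is_loop[OF h] d1 d2 z s by blast+
  have image: "path (F \<circ> p)" "path_image (F \<circ> p) \<subseteq> ?E" if "path p" "path_image p \<subseteq> ?Q" for p
  proof -
    show "path (F \<circ> p)" using that F(1) by (metis path_continuous_image continuous_on_subset)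
    show "path_image (F \<circ> p) \<subseteq> ?E" using that F(2) by (simp add: path_image_compose) (metis image_mono image_subset_iff_funcset subset_trans)
  qed
  have cl: "loop_at ?E e (F \<circ> row (-1))"
    using image[OF row(1) rowQ, of "-1"] by (auto simp: loop_at_def row pathstart_compose pathfinish_compose Fe)
  have eq1: "homotopic_paths ?E (F \<circ> side (-1)) (meridian_loop h d1 z1 s)"
    by (intro homotopic_paths_eq image side sideQ ml1) auto
  have eq2: "homotopic_paths ?E (F \<circ> side 2) (meridian_loop h d2 z2 s)"
    by (intro homotopic_paths_eq image side sideQ ml2) auto
  have hom: "homotopic_paths ?E (F \<circ> (side (-1) +++ row 2)) (F \<circ> (row (-1) +++ side 2))"
    by (rule homotopic_paths_convex_image[OF cv F])
      (auto simp: side row path_image_join simp del: mem_Times_iff dest!: subsetD[OF sideQ, rotated] subsetD[OF rowQ, rotated])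
  have "homotopic_paths ?E (meridian_loop h d1 z1 s +++ (F \<circ> row (-1))) ((F \<circ> side (-1)) +++ (F \<circ> row 2))"
    using eq1 eq2 cl loops unfolding rows
    by (intro homotopic_paths_join) (auto simp: loop_at_def homotopic_paths_sym)
  also have "homotopic_paths ?E \<dots> ((F \<circ> row (-1)) +++ (F \<circ> side 2))"
    using hom by (simp add: path_compose_join)
  also have "homotopic_paths ?E \<dots> ((F \<circ> row (-1)) +++ meridian_loop h d2 z2 s)"
    using eq1 eq2 cl loops
    by (intro homotopic_paths_join) (auto simp: loop_at_def side pathstart_compose Fe)
  finally have "path_class ?E (meridian_loop h d1 z1 s +++ (F \<circ> row (-1))) =
      path_class ?E ((F \<circ> row (-1)) +++ meridian_loop h d2 z2 s)"
    by (rule path_class_eqI)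
  then show ?thesis unfolding G_def
    using cl loops by (intro bexI[OF _ path_class_carrier[OF cl]]) (simp add: mult_fundamental_group)
qed

text \<open>\<open>meridians\<close> allows both directions around the fibre disc; running the fibre
  circle backwards inverts the class.\<close>

lemma meridian_loop_inverse:
  assumes h: "tubular_neighbourhood h K"
    and d: "path d" "path_image d \<subseteq> knot_exterior h" "pathstart d = e" "pathfinish d = h (z, 1)"
    and z: "z \<in> S1" and s: "s = 1 \<or> s = (-1::real)"
  defines "G \<equiv> knot_group h e"
  shows "path_class (knot_exterior h) (meridian_loop h d z s) \<otimes>\<^bsub>G\<^esub>
     path_class (knot_exterior h) (meridian_loop h d z (- s)) = \<one>\<^bsub>G\<^esub>"
proof -
  let ?E = "knot_exterior h"
  let ?l = "\<lambda>s t. h (z, cis (s * 2 * pi * t))"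
  have loops: "loop_at ?E e (meridian_loop h d z s)" "loop_at ?E e (meridian_loop h d z (- s))"
    using meridian_loop_is_loop[OF h d z] s by auto
  note l = fibre_loop[OF h z s]
  have "cis (- s * 2 * pi * t) = cis (s * 2 * pi * (1 - t))" for t
    using s by (auto simp: complex_eq_iff algebra_simps cos_diff sin_diff)
  then have "?l (- s) = reversepath (?l s)"
    by (simp add: reversepath_def fun_eq_iff)
  \<comment> \<open>The two sides differ only in the bracketing of the triple join.\<close>
  then have "homotopic_paths ?E (meridian_loop h d z (- s)) (reversepath (meridian_loop h d z s))"
    using d l by (auto simp: meridian_loop_def reversepath_joinpaths intro!: homotopic_paths_assoc)
  moreover have "homotopic_paths ?E (meridian_loop h d z s) (meridian_loop h d z s)"
    "pathfinish (meridian_loop h d z s) = pathstart (meridian_loop h d z (- s))"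
    using loops by (simp_all add: loop_at_def)
  ultimately have "homotopic_paths ?E (meridian_loop h d z s +++ meridian_loop h d z (- s))
      (meridian_loop h d z s +++ reversepath (meridian_loop h d z s))"
    by (intro homotopic_paths_join)
  also have "homotopic_paths ?E \<dots> (linepath e e)"
    using homotopic_paths_rinv[of "meridian_loop h d z s" ?E] loops by (simp add: loop_at_def)
  finally have "homotopic_paths ?E (meridian_loop h d z s +++ meridian_loop h d z (- s)) (linepath e e)" .
  then have "path_class ?E (meridian_loop h d z s +++ meridian_loop h d z (- s)) = path_class ?E (linepath e e)"
    by (rule path_class_eqI)
  then show ?thesis unfolding G_def
    using loops by (simp add: mult_fundamental_group fundamental_group_def[THEN arg_cong[where f = one]])
qed

lemma meridians_conjugate:
  assumes h: "tubular_neighbourhood h K" and \<mu>: "\<mu> \<in> meridians h e" "\<nu> \<in> meridians h e"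
  defines "G \<equiv> knot_group h e"
  obtains c \<nu>' where "c \<in> carrier G" "\<nu>' \<in> carrier G" "\<mu> \<otimes>\<^bsub>G\<^esub> c = c \<otimes>\<^bsub>G\<^esub> \<nu>'"
    "\<nu>' = \<nu> \<or> \<nu>' \<otimes>\<^bsub>G\<^esub> \<nu> = \<one>\<^bsub>G\<^esub>"
proof -
  let ?E = "knot_exterior h"
  obtain d1 z1 s1 where 1: "\<mu> = path_class ?E (meridian_loop h d1 z1 s1)" "path d1"
    "path_image d1 \<subseteq> ?E" "pathstart d1 = e" "pathfinish d1 = h (z1, 1)" "z1 \<in> S1" "s1 = 1 \<or> s1 = -1"
    using \<mu>(1) unfolding meridians_def meridian_loop_def by blast
  obtain d2 z2 s2 where 2: "\<nu> = path_class ?E (meridian_loop h d2 z2 s2)" "path d2"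
    "path_image d2 \<subseteq> ?E" "pathstart d2 = e" "pathfinish d2 = h (z2, 1)" "z2 \<in> S1" "s2 = 1 \<or> s2 = -1"
    using \<mu>(2) unfolding meridians_def meridian_loop_def by blast
  \<comment> \<open>The second meridian run in the direction of the first, since the square joins
    only loops of equal direction.\<close>
  define \<nu>' where "\<nu>' = path_class ?E (meridian_loop h d2 z2 s1)"
  have "\<nu>' \<in> carrier G"
    unfolding G_def \<nu>'_def by (intro path_class_carrier meridian_loop_is_loop[OF h 2(2-6) 1(7)])
  moreover obtain c where "c \<in> carrier G" "\<mu> \<otimes>\<^bsub>G\<^esub> c = c \<otimes>\<^bsub>G\<^esub> \<nu>'"
    using meridian_loops_conjugate[OF h 1(2-5) 2(2-5) 1(6) 2(6) 1(7)] unfolding G_def 1(1) \<nu>'_def by blast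
  moreover have "\<nu>' = \<nu> \<or> \<nu>' \<otimes>\<^bsub>G\<^esub> \<nu> = \<one>\<^bsub>G\<^esub>"
    using meridian_loop_inverse[OF h 2(2-6) 1(7)] 1(7) 2(7) unfolding G_def \<nu>'_def 2(1)
    by fastforce
  ultimately show ?thesis using that by blast
qed

section \<open>Holonomy on planar maps\<close>

text \<open>Think of the graph with the classes of \<open>comp0\<close> as vertices and
  \<open>E\<close> as edges, added one at a time. An edge inside a component leaves the components
  alone and makes the inequality strict. An edge between two components lowers their number by at
  most one, and the potential can be adjusted on one of them.\<close>

lemma (in group) potential_or_few_components:
  fixes \<phi> \<alpha> :: "'d \<Rightarrow> 'd" and comp0 :: "'d \<Rightarrow> 'l"
  assumes D: "finite D" "\<phi> \<in> D \<rightarrow> D" "\<alpha> \<in> D \<rightarrow> D" and w: "w \<in> D \<rightarrow> carrier G"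
    and comp0: "\<And>d. d \<in> D \<Longrightarrow> comp0 (\<phi> d) = comp0 d"
    and E: "finite E" "E \<subseteq> D"
  shows "\<exists>comp :: 'd \<Rightarrow> 'l. (\<forall>d\<in>D. comp (\<phi> d) = comp d) \<and> (\<forall>d\<in>E. comp (\<alpha> d) = comp d) \<and>
    (card (comp0 ` D) < card (comp ` D) + card E \<or>
     card (comp0 ` D) \<le> card (comp ` D) + card E \<and>
     (\<exists>g\<in>D \<rightarrow> carrier G. (\<forall>d\<in>D. g (\<phi> d) = g d) \<and> (\<forall>d\<in>E. g (\<alpha> d) = g d \<otimes> w d)))"
  using E
proof (induction E rule: finite_induct)
  case empty
  show ?case
    by (intro exI[of _ comp0]) (auto simp: comp0 intro!: disjI2 bexI[of _ "\<lambda>_. \<one>"])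
next
  case (insert a E)
  then have "E \<subseteq> D" by simp
  from insert.IH[OF this] obtain comp :: "'d \<Rightarrow> 'l" where comp: "\<forall>d\<in>D. comp (\<phi> d) = comp d" "\<forall>d\<in>E. comp (\<alpha> d) = comp d"
    and alt: "card (comp0 ` D) < card (comp ` D) + card E \<or>
     card (comp0 ` D) \<le> card (comp ` D) + card E \<and>
     (\<exists>g\<in>D \<rightarrow> carrier G. (\<forall>d\<in>D. g (\<phi> d) = g d) \<and> (\<forall>d\<in>E. g (\<alpha> d) = g d \<otimes> w d))"
    by blast
  have a: "a \<in> D" "\<alpha> a \<in> D" using insert.prems D by auto
  show ?case
  proof (cases "comp (\<alpha> a) = comp a")
    case True
    then show ?thesis using comp alt insert.hyps by (intro exI[of _ comp]) auto
  next
    case False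
    define comp' where "comp' d = (if comp d = comp (\<alpha> a) then comp a else comp d)" for d
    have "comp ` D \<subseteq> insert (comp (\<alpha> a)) (comp' ` D)" by (auto simp: comp'_def)
    then have "card (comp ` D) \<le> card (insert (comp (\<alpha> a)) (comp' ` D))"
      using D(1) by (intro card_mono) auto
    also have "\<dots> \<le> Suc (card (comp' ` D))" by (simp add: card_insert_le_m1 D(1) card_insert_if)
    finally have card: "card (comp ` D) \<le> Suc (card (comp' ` D))" .
    have comp': "\<forall>d\<in>D. comp' (\<phi> d) = comp' d" "\<forall>d\<in>insert a E. comp' (\<alpha> d) = comp' d"
      using comp False by (auto simp: comp'_def)
    show ?thesis
    proof (cases "card (comp0 ` D) < card (comp ` D) + card E")
      case True
      then show ?thesis using comp' card insert.hyps by (intro exI[of _ comp']) auto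
    next
      case eq: False
      then obtain g where g: "g \<in> D \<rightarrow> carrier G" "\<forall>d\<in>D. g (\<phi> d) = g d"
        "\<forall>d\<in>E. g (\<alpha> d) = g d \<otimes> w d" using alt by auto
      have gc: "g d \<in> carrier G" "w d \<in> carrier G" if "d \<in> D" for d using g(1) w that by auto
      \<comment> \<open>Chosen so that the new edge gets the right difference. Multiplying one
        component on the left keeps the differences already arranged, since \<open>w d\<close> acts
        on the right.\<close>
      define c where "c = g a \<otimes> w a \<otimes> inv (g (\<alpha> a))"
      have c: "c \<in> carrier G" using gc a by (simp add: c_def)
      define g' where "g' d = (if comp d = comp (\<alpha> a) then c \<otimes> g d else g d)" for d
      have "g' \<in> D \<rightarrow> carrier G" using gc c by (auto simp: g'_def)
      moreover have "\<forall>d\<in>D. g' (\<phi> d) = g' d" using g(2) comp(1) by (auto simp: g'_def)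
      moreover have "g' (\<alpha> d) = g' d \<otimes> w d" if "d \<in> insert a E" for d
      proof (cases "d = a")
        case True
        then show ?thesis using False gc a by (simp add: g'_def c_def m_assoc)
      next
        case d: False
        then have "d \<in> E" "d \<in> D" using that insert.prems by auto
        then show ?thesis using g(3) comp(2) c gc by (auto simp: g'_def m_assoc)
      qed
      ultimately show ?thesis using comp' card insert.hyps alt
        by (intro exI[of _ comp']) auto
    qed
  qed
qed

text \<open>\<open>orbit\<close> starts at the first iterate, so one inclusion is trivial. For
  equality, \<open>\<phi>\<close> maps the orbit of \<open>d\<close> injectively into that of
  \<open>\<phi> d\<close>, and the sets are finite.\<close>

lemma orbit_step_finite:
  assumes D: "finite D" "\<phi> \<in> D \<rightarrow> D" "inj_on \<phi> D" "d \<in> D"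
  shows "orbit \<phi> (\<phi> d) = orbit \<phi> d"
proof -
  have sub: "orbit \<phi> d \<subseteq> D"
  proof
    fix x assume "x \<in> orbit \<phi> d"
    then show "x \<in> D" by induction (use D in auto)
  qed
  have "\<phi> x \<in> orbit \<phi> (\<phi> d)" if "x \<in> orbit \<phi> d" for x
    using that by induction (auto intro: orbit.intros)
  then have "\<phi> ` orbit \<phi> d \<subseteq> orbit \<phi> (\<phi> d)" by auto
  moreover have le: "orbit \<phi> (\<phi> d) \<subseteq> orbit \<phi> d"
  proof
    fix x assume "x \<in> orbit \<phi> (\<phi> d)"
    then show "x \<in> orbit \<phi> d" by induction (auto intro: orbit.intros)
  qed
  moreover have "card (\<phi> ` orbit \<phi> d) = card (orbit \<phi> d)"
    using D(3) sub by (intro card_image) (rule inj_on_subset)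
  moreover have "finite (orbit \<phi> d)" using sub D(1) finite_subset by blast
  ultimately show ?thesis by (metis card_mono card_subset_eq finite_subset le_antisym)
qed

text \<open>A dart \<open>d\<close> crosses from the face on its left to the one on the left of \<open>\<alpha> d\<close>, so
  \<open>\<rho> d = \<phi> (\<alpha> d)\<close> is the next dart around the origin of \<open>d\<close>. The darts of \<open>P\<close> lead
  from the vertices other than the root to their parents in a spanning tree, and the edges of
  \<open>E\<close> are those outside the tree. By Euler's formula, the faces together with \<open>E\<close> form a tree as
  soon as they form a connected graph, so there is a potential with the prescribed differences
  across \<open>E\<close>. Stripping leaves off the spanning tree shows first that the graph is connected, then
  that the potential has the right differences across all edges.\<close>

lemma (in group) planar_holonomy:
  fixes \<phi> \<alpha> \<rho> :: "'d \<Rightarrow> 'd" and w :: "'d \<Rightarrow> 'a" and \<mu> :: "'d \<Rightarrow> nat"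
  assumes D: "finite D" "\<phi> \<in> D \<rightarrow> D" "inj_on \<phi> D" "\<alpha> \<in> D \<rightarrow> D" "\<And>d. d \<in> D \<Longrightarrow> \<alpha> (\<alpha> d) = d"
    and \<rho>: "\<And>d. d \<in> D \<Longrightarrow> \<rho> d = \<phi> (\<alpha> d)" "\<And>d. d \<in> D \<Longrightarrow> \<rho> (\<rho> (\<rho> (\<rho> d))) = d"
    and w: "w \<in> D \<rightarrow> carrier G" "\<And>d. d \<in> D \<Longrightarrow> w (\<alpha> d) = inv (w d)"
    and PE: "P \<subseteq> D" "E \<subseteq> D" "\<And>d. d \<in> D \<Longrightarrow> d \<in> P \<or> \<alpha> d \<in> P \<or> d \<in> E \<or> \<alpha> d \<in> E"
    and card: "card E + 1 \<le> card (orbit \<phi> ` D)"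
    and rel: "\<And>d. d \<in> P \<Longrightarrow> w d \<otimes> (w (\<rho> d) \<otimes> (w (\<rho> (\<rho> d)) \<otimes> w (\<rho> (\<rho> (\<rho> d))))) = \<one>"
    and \<mu>: "\<And>d e. d \<in> P \<Longrightarrow> e \<in> {\<rho> d, \<rho> (\<rho> d), \<rho> (\<rho> (\<rho> d))} \<Longrightarrow>
      (e \<in> P \<longrightarrow> \<mu> e < \<mu> d) \<and> (\<alpha> e \<in> P \<longrightarrow> \<mu> (\<alpha> e) < \<mu> d)"
    and conn: "\<And>(c :: 'd \<Rightarrow> 'd set) d d'.
      (\<And>d. d \<in> D \<Longrightarrow> c (\<phi> d) = c d \<and> c (\<alpha> d) = c d) \<Longrightarrow> d \<in> D \<Longrightarrow> d' \<in> D \<Longrightarrow> c d = c d'"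
    and d: "d \<in> D"
  shows "w d \<otimes> (w (\<rho> d) \<otimes> (w (\<rho> (\<rho> d)) \<otimes> w (\<rho> (\<rho> (\<rho> d))))) = \<one>"
proof -
  have \<rho>D: "\<rho> d \<in> D" if "d \<in> D" for d using that \<rho>(1) D by fastforce
  \<comment> \<open>Peels the tree from its leaves: a property of edges passes to a tree dart once
    the other three edges at its origin have it, and these come from \<open>E\<close> or are tree
    edges of smaller \<open>\<mu>\<close>.\<close>
  have strip: "Q d" if Qa: "\<And>d. d \<in> D \<Longrightarrow> Q (\<alpha> d) \<longleftrightarrow> Q d" and QE: "\<And>d. d \<in> E \<Longrightarrow> Q d"
    and QP: "\<And>d. d \<in> P \<Longrightarrow> Q (\<rho> d) \<Longrightarrow> Q (\<rho> (\<rho> d)) \<Longrightarrow> Q (\<rho> (\<rho> (\<rho> d))) \<Longrightarrow> Q d"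
    and d: "d \<in> D" for Q d
  proof -
    have "Q d" if "d \<in> P" for d using that
    proof (induction d rule: measure_induct_rule[of \<mu>])
      case (less d)
      then have dD: "d \<in> D" using PE by auto
      have "Q e" if e: "e \<in> {\<rho> d, \<rho> (\<rho> d), \<rho> (\<rho> (\<rho> d))}" for e
      proof -
        have eD: "e \<in> D" using e \<rho>D dD by auto
        then consider "e \<in> P" | "\<alpha> e \<in> P" | "e \<in> E" | "\<alpha> e \<in> E" using PE by blast
        then show ?thesis using less.IH \<mu>[OF less.prems e] QE Qa[OF eD] by cases auto
      qed
      then show ?case using QP[OF less.prems] by blast
    qed
    then show ?thesis using PE(3)[OF d] QE Qa[OF d] by blast
  qed
  have orb: "orbit \<phi> (\<phi> d) = orbit \<phi> d" if "d \<in> D" for d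
    using orbit_step_finite[OF D(1-3) that] .
  obtain comp :: "'d \<Rightarrow> 'd set" where comp: "\<forall>d\<in>D. comp (\<phi> d) = comp d" "\<forall>d\<in>E. comp (\<alpha> d) = comp d"
    and alt: "card (orbit \<phi> ` D) < card (comp ` D) + card E \<or>
     card (orbit \<phi> ` D) \<le> card (comp ` D) + card E \<and>
     (\<exists>g\<in>D \<rightarrow> carrier G. (\<forall>d\<in>D. g (\<phi> d) = g d) \<and> (\<forall>d\<in>E. g (\<alpha> d) = g d \<otimes> w d))"
    using potential_or_few_components[where \<phi> = \<phi> and ?comp0.0 = "orbit \<phi>",
        OF D(1,2,4) w(1) orb finite_subset[OF PE(2) D(1)] PE(2)] by blast
  \<comment> \<open>First use: \<open>\<rho> d\<close> and \<open>\<alpha> d\<close> bound the same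
    face, so if three edges at a vertex do not separate components, neither does the fourth.\<close>
  have "comp (\<alpha> d) = comp d" if "d \<in> D" for d
  proof (rule strip[where Q = "\<lambda>d. comp (\<alpha> d) = comp d", OF _ _ _ that])
    fix d assume d: "d \<in> P" and r: "comp (\<alpha> (\<rho> d)) = comp (\<rho> d)"
      "comp (\<alpha> (\<rho> (\<rho> d))) = comp (\<rho> (\<rho> d))" "comp (\<alpha> (\<rho> (\<rho> (\<rho> d)))) = comp (\<rho> (\<rho> (\<rho> d)))"
    have dD: "d \<in> D" using d PE by auto
    have "comp (\<rho> d) = comp (\<alpha> d)" if "d \<in> D" for d using that comp(1) \<rho>(1) D(4) by auto
    then show "comp (\<alpha> d) = comp d" using r \<rho>(2)[OF dD] \<rho>D dD by metis
  qed (use comp D in auto)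
  then have "comp d' = comp d" if "d' \<in> D" for d' using conn[of comp d' d] comp(1) that d by auto
  then have "comp ` D \<subseteq> {comp d}" by auto
  then have "card (comp ` D) \<le> 1" using card_mono[of "{comp d}"] by auto
  \<comment> \<open>With a single component the strict alternative contradicts the face count, which
    leaves the potential.\<close>
  then obtain g where g: "g \<in> D \<rightarrow> carrier G" "\<And>d. d \<in> D \<Longrightarrow> g (\<phi> d) = g d"
    "\<And>d. d \<in> E \<Longrightarrow> g (\<alpha> d) = g d \<otimes> w d" using alt card by auto
  have gc: "g d \<in> carrier G" "w d \<in> carrier G" if "d \<in> D" for d using g(1) w that by auto
  have g\<rho>: "g (\<rho> d) = g (\<alpha> d)" if "d \<in> D" for d using that g(2) \<rho>(1) D(4) by auto
  \<comment> \<open>Second use: three differences around a tree vertex, together with its relation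
    \<open>rel\<close>, force the fourth.\<close>
  have flat: "g (\<alpha> d) = g d \<otimes> w d" if "d \<in> D" for d
  proof (rule strip[where Q = "\<lambda>d. g (\<alpha> d) = g d \<otimes> w d", OF _ _ _ that])
    fix d assume d: "d \<in> D"
    have a: "\<alpha> d \<in> D" using d D by auto
    show "g (\<alpha> (\<alpha> d)) = g (\<alpha> d) \<otimes> w (\<alpha> d) \<longleftrightarrow> g (\<alpha> d) = g d \<otimes> w d"
      using gc[OF d] gc[OF a] D(5)[OF d] w(2)[OF d] by (metis inv_closed inv_solve_right)
  next
    fix d assume d: "d \<in> P" and r: "g (\<alpha> (\<rho> d)) = g (\<rho> d) \<otimes> w (\<rho> d)"
      "g (\<alpha> (\<rho> (\<rho> d))) = g (\<rho> (\<rho> d)) \<otimes> w (\<rho> (\<rho> d))"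
      "g (\<alpha> (\<rho> (\<rho> (\<rho> d)))) = g (\<rho> (\<rho> (\<rho> d))) \<otimes> w (\<rho> (\<rho> (\<rho> d)))"
    have dD: "d \<in> D" using d PE by auto
    note cl = gc[OF dD] gc[OF \<rho>D[OF dD]] gc[OF \<rho>D[OF \<rho>D[OF dD]]] gc[OF \<rho>D[OF \<rho>D[OF \<rho>D[OF dD]]]]
    let ?v = "w (\<rho> d) \<otimes> (w (\<rho> (\<rho> d)) \<otimes> w (\<rho> (\<rho> (\<rho> d))))"
    have "g d = g (\<alpha> d) \<otimes> ?v"
      using r g\<rho>[OF dD] g\<rho>[OF \<rho>D[OF dD]] g\<rho>[OF \<rho>D[OF \<rho>D[OF dD]]] g\<rho>[OF \<rho>D[OF \<rho>D[OF \<rho>D[OF dD]]]]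
        \<rho>(2)[OF dD] cl by (simp add: m_assoc)
    moreover have "w d = inv ?v" using rel[OF d] cl by (intro inv_equality[symmetric]) auto
    moreover have "g (\<alpha> d) \<in> carrier G" using gc D dD by auto
    ultimately show "g (\<alpha> d) = g d \<otimes> w d" using cl by (simp add: m_assoc r_inv)
  qed (use g in auto)
  note cl = gc[OF d] gc[OF \<rho>D[OF d]] gc[OF \<rho>D[OF \<rho>D[OF d]]] gc[OF \<rho>D[OF \<rho>D[OF \<rho>D[OF d]]]]
  have "g d = g d \<otimes> (w d \<otimes> (w (\<rho> d) \<otimes> (w (\<rho> (\<rho> d)) \<otimes> w (\<rho> (\<rho> (\<rho> d))))))"
    using flat[OF d] flat[OF \<rho>D[OF d]] flat[OF \<rho>D[OF \<rho>D[OF d]]] flat[OF \<rho>D[OF \<rho>D[OF \<rho>D[OF d]]]]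
      g\<rho>[OF d] g\<rho>[OF \<rho>D[OF d]] g\<rho>[OF \<rho>D[OF \<rho>D[OF d]]] g\<rho>[OF \<rho>D[OF \<rho>D[OF \<rho>D[OF d]]]]
      \<rho>(2)[OF d] cl by (simp add: m_assoc)
  then show ?thesis using cl by (metis l_cancel_one m_closed)
qed

section \<open>The redundant Wirtinger relator\<close>

lemma crossing_opposite [simp]: "crossing (opposite p) = crossing p"
  and is_Over_opposite [simp]: "is_Over (opposite p) \<longleftrightarrow> \<not> is_Over p"
  and opposite_opposite [simp]: "opposite (opposite p) = p"
  by (cases p; simp)+

lemma knot_diagram_code:
  assumes D: "knot_diagram n D"
  shows length_code: "length (code D) = 2 * n"
    and opposite_in_code: "p \<in> set (code D) \<Longrightarrow> opposite p \<in> set (code D)"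
    and crossing_in_range: "p \<in> set (code D) \<Longrightarrow> crossing p \<in> {1..n}"
proof -
  have d: "distinct (code D)" and s: "set (code D) = Over ` {1..n} \<union> Under ` {1..n}"
    using D by (auto simp: knot_diagram_def)
  have "card (Over ` {1..n} \<union> Under ` {1..n}) = n + n"
    by (subst card_Un_disjoint) (auto simp: card_image inj_on_def)
  then show "length (code D) = 2 * n" using d s distinct_card by force
  show "p \<in> set (code D) \<Longrightarrow> opposite p \<in> set (code D)" by (auto simp: s)
  show "p \<in> set (code D) \<Longrightarrow> crossing p \<in> {1..n}" by (auto simp: s)
qed

lemma position_code:
  assumes D: "knot_diagram n D"
  shows position_nth: "t < 2 * n \<Longrightarrow> position D (code D ! t) = t"
    and position_less: "p \<in> set (code D) \<Longrightarrow> position D p < 2 * n"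
    and nth_position: "p \<in> set (code D) \<Longrightarrow> code D ! position D p = p"
proof -
  have d: "distinct (code D)" using D by (auto simp: knot_diagram_def)
  show nth: "position D (code D ! t) = t" if "t < 2 * n" for t
    unfolding position_def using that d length_code[OF D]
    by (intro the_equality) (auto simp: nth_eq_iff_index_eq)
  show "p \<in> set (code D) \<Longrightarrow> position D p < 2 * n" "p \<in> set (code D) \<Longrightarrow> code D ! position D p = p"
    using nth length_code[OF D] by (auto simp: in_set_conv_nth)
qed

text \<open>Advancing by one passage rotates the code one place further and puts passage
  \<open>t\<close> at its end, where \<open>last\<close> finds it if it is an underpassage.\<close>

lemma arc_into_next:
  assumes D: "knot_diagram n D" and t: "t < 2 * n"
  shows "arc_into D (code D ! (Suc t mod (2 * n))) =
    (if is_Over (code D ! t) then arc_into D (code D ! t) else crossing (code D ! t))"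
proof -
  let ?N = "2 * n" and ?u = "\<lambda>q. \<not> is_Over q"
  have len: "length (code D) = ?N" by (rule length_code[OF D])
  have "Suc t mod ?N < ?N" using t by simp
  then have "position D (code D ! (Suc t mod ?N)) = Suc t mod ?N" by (rule position_nth[OF D])
  moreover have "rotate (Suc t mod ?N) (code D) = rotate1 (rotate t (code D))"
    using rotate_conv_mod[of "Suc t" "code D"] len by simp
  moreover have "rotate t (code D) = code D ! t # tl (rotate t (code D))"
    using t len hd_rotate_conv_nth[of "code D" t]
    by (metis hd_Cons_tl length_0_conv less_zeroE mod_less rotate_is_Nil_conv)
  then obtain ys where ys: "rotate t (code D) = code D ! t # ys" by blast
  ultimately show ?thesis using ys position_nth[OF D t] by (auto simp: arc_into_def)
qed

text \<open>Every rotation of the code contains an underpassage, so the value is in range even where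
  \<open>position\<close> is unspecified.\<close>

lemma arc_into_range:
  assumes D: "knot_diagram n D"
  shows "arc_into D p \<in> {1..n}"
proof -
  let ?f = "filter (\<lambda>q. \<not> is_Over q) (rotate (position D p) (code D))"
  have "Under 1 \<in> set (code D)" using D by (auto simp: knot_diagram_def)
  then have "?f \<noteq> []" by (force simp: filter_empty_conv)
  then have "last ?f \<in> set (code D)" using last_in_set[of ?f] by auto
  then show ?thesis unfolding arc_into_def by (rule crossing_in_range[OF D])
qed

section \<open>Darts around a crossing and their labels\<close>

definition reverse_dart :: "nat \<times> bool \<Rightarrow> nat \<times> bool" where
  "reverse_dart d = (fst d, \<not> snd d)"

text \<open>The dart that leaves passage \<open>t\<close>, along the orientation of the knot if \<open>s\<close> holds.\<close>

definition dart_from :: "nat \<Rightarrow> nat \<Rightarrow> bool \<Rightarrow> nat \<times> bool" where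
  "dart_from N t s = (if s then t else (t + N - 1) mod N, s)"

lemma Suc_pred_mod: "t < N \<Longrightarrow> Suc ((t + N - 1) mod N) mod N = (t::nat)"
  by (cases t) (auto simp: mod_Suc)

lemma dart_from_surj:
  assumes "d \<in> {..<N} \<times> UNIV" obtains t s where "t < N" "d = dart_from N t s"
proof (cases "snd d")
  case True
  then show ?thesis using assms that[of "fst d" True] by (auto simp: dart_from_def prod_eq_iff)
next
  case False
  have f: "fst d < N" using assms by auto
  then have "(Suc (fst d) mod N + N - 1) mod N = fst d"
    by (cases "Suc (fst d) = N") auto
  then show ?thesis using f False that[of "Suc (fst d) mod N" False]
    by (auto simp: dart_from_def prod_eq_iff)
qed

text \<open>Arriving at a crossing and turning left is the same as moving clockwise to the next
  outgoing dart. It lies on the other strand; the sign of the crossing and the strand left decide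
  its direction.\<close>

lemma next_dart_from:
  assumes D: "knot_diagram n D" and t: "t < 2 * n"
  defines "p \<equiv> code D ! t"
  shows "next_dart D (reverse_dart (dart_from (2 * n) t s)) =
    dart_from (2 * n) (position D (opposite p)) (s \<noteq> (is_Over p = positive D (crossing p)))"
proof -
  have "code D ! (Suc ((t + 2 * n - 1) mod (2 * n)) mod (2 * n)) = p"
    using Suc_pred_mod[OF t] by (simp add: p_def)
  then show ?thesis
    using t length_code[OF D]
    by (cases s) (auto simp: next_dart_def dart_from_def reverse_dart_def Let_def p_def)
qed

lemma (in group) cyclic_product_eq_one:
  assumes "x \<in> carrier G" "y \<in> carrier G" "z \<in> carrier G" "v \<in> carrier G"
  shows "y \<otimes> (z \<otimes> (v \<otimes> x)) = \<one> \<longleftrightarrow> x \<otimes> (y \<otimes> (z \<otimes> v)) = \<one>"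
proof -
  have "y \<otimes> (z \<otimes> (v \<otimes> x)) = (y \<otimes> (z \<otimes> v)) \<otimes> x" using assms by (simp add: m_assoc)
  then show ?thesis using assms by (metis inv_comm m_closed)
qed

text \<open>The right-hand sides are the labels read clockwise around a positive and a negative
  crossing, from the dart leaving along the overstrand. They arise by inverting the relator and
  rotating it.\<close>

lemma (in group) relator_eq_one:
  assumes c: "i \<in> carrier G" "j \<in> carrier G" "k \<in> carrier G"
  shows "i \<otimes> (k \<otimes> (inv i \<otimes> inv j)) = \<one> \<longleftrightarrow> inv i \<otimes> (j \<otimes> (i \<otimes> inv k)) = \<one>"
    and "i \<otimes> (inv j \<otimes> (inv i \<otimes> k)) = \<one> \<longleftrightarrow> inv i \<otimes> (inv k \<otimes> (i \<otimes> j)) = \<one>"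
proof -
  have inv1: "x = \<one> \<longleftrightarrow> inv x = \<one>" if "x \<in> carrier G" for x
    using that by (metis inv_eq_1_iff)
  have "i \<otimes> (k \<otimes> (inv i \<otimes> inv j)) = \<one> \<longleftrightarrow> inv (i \<otimes> (k \<otimes> (inv i \<otimes> inv j))) = \<one>"
    using c by (intro inv1) auto
  also have "inv (i \<otimes> (k \<otimes> (inv i \<otimes> inv j))) = j \<otimes> (i \<otimes> (inv k \<otimes> inv i))"
    using c by (simp add: inv_mult_group m_assoc)
  also have "j \<otimes> (i \<otimes> (inv k \<otimes> inv i)) = \<one> \<longleftrightarrow> inv i \<otimes> (j \<otimes> (i \<otimes> inv k)) = \<one>"
    using c by (intro cyclic_product_eq_one) auto
  finally show "i \<otimes> (k \<otimes> (inv i \<otimes> inv j)) = \<one> \<longleftrightarrow> inv i \<otimes> (j \<otimes> (i \<otimes> inv k)) = \<one>" .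
  have "i \<otimes> (inv j \<otimes> (inv i \<otimes> k)) = \<one> \<longleftrightarrow> inv (i \<otimes> (inv j \<otimes> (inv i \<otimes> k))) = \<one>"
    using c by (intro inv1) auto
  also have "inv (i \<otimes> (inv j \<otimes> (inv i \<otimes> k))) = inv k \<otimes> (i \<otimes> (j \<otimes> inv i))"
    using c by (simp add: inv_mult_group m_assoc)
  also have "inv k \<otimes> (i \<otimes> (j \<otimes> inv i)) = \<one> \<longleftrightarrow> inv i \<otimes> (inv k \<otimes> (i \<otimes> j)) = \<one>"
    using c by (intro cyclic_product_eq_one) auto
  finally show "i \<otimes> (inv j \<otimes> (inv i \<otimes> k)) = \<one> \<longleftrightarrow> inv i \<otimes> (inv k \<otimes> (i \<otimes> j)) = \<one>" .
qed

text \<open>With this choice of signs, the product of the labels around a crossing is the inverse of the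
  relator up to cyclic rotation.\<close>

definition dart_label :: "('g, 'c) monoid_scheme \<Rightarrow> diagram \<Rightarrow> (nat \<Rightarrow> 'g) \<Rightarrow> nat \<times> bool \<Rightarrow> 'g" where
  "dart_label G D M = (\<lambda>(t, fwd).
     let x = M (arc_into D (code D ! (Suc t mod length (code D))))
     in if fwd then inv\<^bsub>G\<^esub> x else x)"

lemma dart_label_from:
  assumes D: "knot_diagram n D" and t: "t < 2 * n"
  defines "p \<equiv> code D ! t"
  shows "dart_label G D M (dart_from (2 * n) t False) = M (arc_into D p)"
    and "dart_label G D M (dart_from (2 * n) t True) =
      inv\<^bsub>G\<^esub> (M (if is_Over p then arc_into D p else crossing p))"
proof -
  have "code D ! (Suc ((t + 2 * n - 1) mod (2 * n)) mod (2 * n)) = p"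
    using Suc_pred_mod[OF t] by (simp add: p_def)
  then show "dart_label G D M (dart_from (2 * n) t False) = M (arc_into D p)"
    using length_code[OF D] by (simp add: dart_label_def dart_from_def Let_def)
  show "dart_label G D M (dart_from (2 * n) t True) =
      inv\<^bsub>G\<^esub> (M (if is_Over p then arc_into D p else crossing p))"
    using arc_into_next[OF D t] length_code[OF D]
    by (simp add: dart_label_def dart_from_def Let_def p_def)
qed

text \<open>The four possible starting darts give cyclic rotations of one product, so the condition
  depends only on the crossing.\<close>

lemma (in group) holonomy_eq_relator:
  fixes s :: bool
  assumes D: "knot_diagram n D" and M: "M \<in> {1..n} \<rightarrow> carrier G" and t: "t < 2 * n"
  defines "w \<equiv> dart_label G D M" and "\<rho> \<equiv> \<lambda>d. next_dart D (reverse_dart d)"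
    and "d \<equiv> dart_from (2 * n) t s"
  shows "w d \<otimes> (w (\<rho> d) \<otimes> (w (\<rho> (\<rho> d)) \<otimes> w (\<rho> (\<rho> (\<rho> d))))) = \<one> \<longleftrightarrow>
    eval_word G M (wirtinger_relator D (crossing (code D ! t))) = \<one>"
proof -
  define c where "c = crossing (code D ! t)"
  let ?f = "dart_from (2 * n)"
  let ?o = "position D (Over c)" and ?u = "position D (Under c)"
  have p: "code D ! t \<in> set (code D)" using t length_code[OF D] by auto
  have t_cases: "code D ! t = Over c \<or> code D ! t = Under c" by (cases "code D ! t") (auto simp: c_def)
  then have in_code: "Over c \<in> set (code D)" "Under c \<in> set (code D)"
    using p opposite_in_code[OF D p] by auto
  have lt: "?o < 2 * n" "?u < 2 * n" using in_code position_less[OF D] by auto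
  have at: "code D ! ?o = Over c" "code D ! ?u = Under c" using in_code nth_position[OF D] by auto
  define i j where "i = arc_into D (Over c)" and "j = arc_into D (Under c)"
  have "c \<in> {1..n}" using crossing_in_range[OF D p] by (simp add: c_def)
  then have cl: "M i \<in> carrier G" "M j \<in> carrier G" "M c \<in> carrier G"
    unfolding i_def j_def using funcset_mem[OF M] arc_into_range[OF D] by simp_all
  have w: "w (?f ?o True) = inv (M i)" "w (?f ?o False) = M i"
    "w (?f ?u True) = inv (M c)" "w (?f ?u False) = M j"
    using dart_label_from[OF D lt(1), of G M] dart_label_from[OF D lt(2), of G M]
    by (simp_all add: w_def at i_def j_def)
  have \<rho>: "\<rho> (?f ?o s) = ?f ?u (s \<noteq> positive D c)" "\<rho> (?f ?u s) = ?f ?o (s = positive D c)" for s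
    using next_dart_from[OF D lt(1), of s] next_dart_from[OF D lt(2), of s]
    by (auto simp: \<rho>_def at)
  have "t = ?o \<or> t = ?u" using t_cases position_nth[OF D t] by metis
  then have d: "d = ?f ?o True \<or> d = ?f ?o False \<or> d = ?f ?u True \<or> d = ?f ?u False"
    by (cases s) (auto simp: d_def)
  note rels = relator_eq_one[OF cl(1,2,3)]
  note cyc = cyclic_product_eq_one
  show ?thesis
  proof (cases "positive D c")
    case True
    have "eval_word G M (wirtinger_relator D c) = M i \<otimes> (M c \<otimes> (inv (M i) \<otimes> inv (M j)))"
      using True cl by (simp add: wirtinger_relator_def eval_word_def Let_def i_def j_def)
    then show ?thesis unfolding c_def[symmetric] using d True cl rels
      cyc[of "inv (M i)" "M j" "M i" "inv (M c)"] cyc[of "M j" "M i" "inv (M c)" "inv (M i)"]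
      cyc[of "M i" "inv (M c)" "inv (M i)" "M j"]
      by (elim disjE) (simp_all add: \<rho> w)
  next
    case False
    have "eval_word G M (wirtinger_relator D c) = M i \<otimes> (inv (M j) \<otimes> (inv (M i) \<otimes> M c))"
      using False cl by (simp add: wirtinger_relator_def eval_word_def Let_def i_def j_def)
    then show ?thesis unfolding c_def[symmetric] using d False cl rels
      cyc[of "inv (M i)" "inv (M c)" "M i" "M j"] cyc[of "inv (M c)" "M i" "M j" "inv (M i)"]
      cyc[of "M i" "M j" "inv (M i)" "inv (M c)"]
      by (elim disjE) (simp_all add: \<rho> w)
  qed
qed

text \<open>The spanning tree consists of the edges along which the crossings are first reached when the
  knot is traversed from the underpassage of \<open>c0\<close>.\<close>

lemma (in group) wirtinger_relator_redundant:
  assumes D: "knot_diagram n D" and M: "M \<in> {1..n} \<rightarrow> carrier G" and c0: "c0 \<in> {1..n}"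
    and rel: "\<And>c. c \<in> {1..n} - {c0} \<Longrightarrow> eval_word G M (wirtinger_relator D c) = \<one>"
  shows "eval_word G M (wirtinger_relator D c0) = \<one>"
proof -
  let ?N = "2 * n"
  let ?f = "dart_from ?N"
  define \<phi> where "\<phi> = next_dart D"
  define \<rho> where "\<rho> d = \<phi> (reverse_dart d)" for d
  define w where "w = dart_label G D M"
  define cr where "cr t = crossing (code D ! t)" for t
  define opp where "opp t = position D (opposite (code D ! t))" for t
  define s where "s = position D (Under c0)"
  \<comment> \<open>Counts the steps from the starting underpassage in cyclic order;
    \<open>h c\<close> is then the passage at which crossing \<open>c\<close> is first met.\<close>
  define r where "r t = (if s \<le> t then t - s else t + ?N - s)" for t
  define h where "h c = (if r (position D (Over c)) < r (position D (Under c))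
    then position D (Over c) else position D (Under c))" for c
  let ?D = "{..<?N} \<times> (UNIV :: bool set)"
  let ?C = "{1..n} - {c0}"
  \<comment> \<open>The backward dart at a first visit leads to the preceding passage, whose
    crossing has already been met and serves as the parent.\<close>
  define P where "P = (\<lambda>c. ?f (h c) False) ` ?C"
  define E where "E = {d \<in> ?D. snd d \<and> reverse_dart d \<notin> P}"
  \<comment> \<open>\<open>Suc (fst d)\<close> is the passage from which a backward dart departs. A
    child is first met later than its parent, so it gets a smaller value.\<close>
  define \<mu> where "\<mu> d = ?N - r (Suc (fst d) mod ?N)" for d :: "nat \<times> bool"
  have n: "n \<ge> 1" using c0 by auto
  have in_code: "Over c \<in> set (code D)" "Under c \<in> set (code D)" if "c \<in> {1..n}" for c
    using that D by (auto simp: knot_diagram_def)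
  have pos: "position D (Over c) < ?N" "position D (Under c) < ?N"
    "code D ! position D (Over c) = Over c" "code D ! position D (Under c) = Under c" if "c \<in> {1..n}" for c
    using in_code[OF that] position_less[OF D] nth_position[OF D] by blast+
  have code_at: "code D ! t \<in> set (code D)" if "t < ?N" for t using that length_code[OF D] by auto
  have opp: "opp t < ?N" "opp (opp t) = t" "cr (opp t) = cr t"
    "is_Over (code D ! opp t) \<longleftrightarrow> \<not> is_Over (code D ! t)" if t: "t < ?N" for t
    using code_at[OF t] opposite_in_code[OF D] position_less[OF D] nth_position[OF D] position_nth[OF D t]
    by (simp_all add: opp_def cr_def)
  have \<rho>f: "\<rho> (?f t b) = ?f (opp t) (b \<noteq> (is_Over (code D ! t) = positive D (cr t)))" if "t < ?N" for t b
    using next_dart_from[OF D that] by (simp add: \<rho>_def \<phi>_def opp_def cr_def)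
  \<comment> \<open>Two quarter turns lead to the opposite dart on the same strand.\<close>
  have \<rho>2: "\<rho> (\<rho> (?f t b)) = ?f t (\<not> b)" if "t < ?N" for t b
    by (simp add: \<rho>f opp that) (rule arg_cong[where f = "?f t"], blast)
  have fD: "?f t b \<in> ?D" if "t < ?N" for t b using that by (auto simp: dart_from_def)
  have \<rho>4: "\<rho> (\<rho> (\<rho> (\<rho> d))) = d" if "d \<in> ?D" for d
    using that by (elim dart_from_surj) (simp add: \<rho>2)
  have \<rho>D: "\<rho> d \<in> ?D" if "d \<in> ?D" for d
    using that by (elim dart_from_surj) (simp add: \<rho>f fD opp del: mem_Sigma_iff)
  have rev: "reverse_dart d \<in> ?D" "reverse_dart (reverse_dart d) = d" if "d \<in> ?D" for d
    using that by (auto simp: reverse_dart_def)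
  have \<phi>: "\<phi> d = \<rho> (reverse_dart d)" if "d \<in> ?D" for d using rev[OF that] by (simp add: \<rho>_def)
  have \<phi>D: "\<phi> \<in> ?D \<rightarrow> ?D" using \<phi> \<rho>D rev(1) by auto
  have inj: "inj_on \<phi> ?D"
  proof (rule inj_onI)
    fix x y assume "x \<in> ?D" "y \<in> ?D" "\<phi> x = \<phi> y"
    then show "x = y" using \<phi> \<rho>4 rev by metis
  qed
  have M': "M (arc_into D p) \<in> carrier G" for p using M arc_into_range[OF D] by blast
  have w: "w \<in> ?D \<rightarrow> carrier G" "w (reverse_dart d) = inv (w d)" for d
    using M' by (auto simp: w_def dart_label_def reverse_dart_def Let_def split: prod.splits)
  have hol: "w d \<otimes> (w (\<rho> d) \<otimes> (w (\<rho> (\<rho> d)) \<otimes> w (\<rho> (\<rho> (\<rho> d))))) = \<one> \<longleftrightarrow>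
    eval_word G M (wirtinger_relator D (cr t)) = \<one>" if "t < ?N" "d = ?f t b" for d t b
    using holonomy_eq_relator[OF D M that(1), of b] that unfolding w_def \<rho>_def \<phi>_def cr_def by simp
  have s: "s < ?N" "cr s = c0" using pos[OF c0] by (auto simp: s_def cr_def)
  have r_less: "r t < ?N" if "t < ?N" for t using that s by (auto simp: r_def)
  have r_inj: "r t = r t' \<longleftrightarrow> t = t'" if "t < ?N" "t' < ?N" for t t'
    using that s by (auto simp: r_def)
  have r_Suc: "r (Suc t mod ?N) = Suc (r t)" if "t < ?N" "Suc t mod ?N \<noteq> s" for t
    using that s by (auto simp: r_def mod_Suc split: if_splits)
  have hc: "h c < ?N" "cr (h c) = c" "r (h c) < r (opp (h c))" if c: "c \<in> {1..n}" for c
  proof -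
    have "position D (Over c) \<noteq> position D (Under c)" using pos[OF c] by force
    then have "r (position D (Over c)) \<noteq> r (position D (Under c))" using r_inj pos[OF c] by blast
    then show "h c < ?N" "cr (h c) = c" "r (h c) < r (opp (h c))"
      using pos[OF c] by (auto simp: h_def cr_def opp_def)
  qed
  have f_eq: "t = t'" if "?f t False = ?f t' False" "t < ?N" "t' < ?N" for t t'
  proof -
    have "(t + ?N - 1) mod ?N = (t' + ?N - 1) mod ?N" using that(1) by (simp add: dart_from_def)
    then show ?thesis using Suc_pred_mod[OF that(2)] Suc_pred_mod[OF that(3)] by metis
  qed
  have P: "P \<subseteq> ?D"
  proof
    fix d assume "d \<in> P"
    then obtain c where c: "c \<in> ?C" "d = ?f (h c) False" unfolding P_def by blast
    then have "c \<in> {1..n}" by simp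
    with c show "d \<in> ?D" using fD[OF hc(1)] by blast
  qed
  have PF: "\<not> snd d" if "d \<in> P" for d using that by (auto simp: P_def dart_from_def)
  have \<mu>f: "\<mu> (?f t False) = ?N - r t" if "t < ?N" for t
    by (simp only: \<mu>_def dart_from_def fst_conv if_False Suc_pred_mod[OF that])
  \<comment> \<open>One dart for each of the 2n - (n - 1) edges outside the tree; this is one less
    than the number of faces.\<close>
  have cardE: "card E = n + 1"
  proof -
    have "inj_on (\<lambda>c. ?f (h c) False) ?C"
    proof (rule inj_onI)
      fix c c' assume c: "c \<in> ?C" "c' \<in> ?C" "?f (h c) False = ?f (h c') False"
      have cc: "c \<in> {1..n}" "c' \<in> {1..n}" using c(1,2) by blast+
      have "h c = h c'" by (rule f_eq[OF c(3) hc(1)[OF cc(1)] hc(1)[OF cc(2)]])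
      then show "c = c'" using hc(2)[OF cc(1)] hc(2)[OF cc(2)] by metis
    qed
    then have cP: "card P = n - 1" using c0 by (simp only: P_def card_image) simp
    have Eeq: "E = reverse_dart ` ({..<?N} \<times> {False} - P)"
    proof (intro subset_antisym subsetI)
      fix d assume d: "d \<in> E"
      obtain t b where tb: "d = (t, b)" by (cases d)
      have "t < ?N" "b" "(t, False) \<notin> P" using d by (auto simp: E_def reverse_dart_def tb)
      then have "(t, False) \<in> {..<?N} \<times> {False} - P" "d = reverse_dart (t, False)"
        by (simp_all add: reverse_dart_def tb)
      then show "d \<in> reverse_dart ` ({..<?N} \<times> {False} - P)" by (rule rev_image_eqI)
    next
      fix d assume "d \<in> reverse_dart ` ({..<?N} \<times> {False} - P)"
      then obtain x where x: "d = reverse_dart x" "x \<in> {..<?N} \<times> {False}" "x \<notin> P" by blast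
      obtain t b where tb: "x = (t, b)" by (cases x)
      show "d \<in> E" using x by (simp add: E_def reverse_dart_def tb)
    qed
    have inj: "inj_on reverse_dart ({..<?N} \<times> {False} - P)"
      by (auto simp: inj_on_def reverse_dart_def prod_eq_iff)
    have "P \<subseteq> {..<?N} \<times> {False}" 
    proof
      fix d assume d: "d \<in> P"
      then have "d \<in> ?D" "\<not> snd d" using P PF by blast+
      then show "d \<in> {..<?N} \<times> {False}" by (simp add: mem_Times_iff)
    qed
    then have "card ({..<?N} \<times> {False} - P) = ?N - card P"
      using card_Diff_subset[of P "{..<?N} \<times> {False}"] finite_subset[OF P] by simp
    then have "card E = ?N - card P" by (simp only: Eeq card_image[OF inj])
    then show ?thesis using cP n by simp
  qed
  have card: "card E + 1 \<le> card (orbit \<phi> ` ?D)"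
    using D length_code[OF D] by (simp add: cardE \<phi>_def knot_diagram_def darts_def)
  have \<mu>: "(e \<in> P \<longrightarrow> \<mu> e < \<mu> d) \<and> (reverse_dart e \<in> P \<longrightarrow> \<mu> (reverse_dart e) < \<mu> d)"
    if "d \<in> P" and e: "e \<in> {\<rho> d, \<rho> (\<rho> d), \<rho> (\<rho> (\<rho> d))}" for d e
  proof -
    obtain c where c: "c \<in> ?C" and d: "d = ?f (h c) False" using \<open>d \<in> P\<close> unfolding P_def by blast
    have c1: "c \<in> {1..n}" using c by auto
    let ?t = "h c"
    note t = hc[OF c1]
    \<comment> \<open>The reverse of a forward dart is in the tree only if the next passage is a
      first visit, which comes one step later. That passage is not \<open>s\<close>, where the count
      restarts, since \<open>c0\<close> contributes no tree edge.\<close>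
    have out: "reverse_dart (?f t True) \<in> P \<longrightarrow> \<mu> (reverse_dart (?f t True)) < \<mu> d"
      if tN: "t < ?N" and rt: "r ?t \<le> r t" for t
    proof
      assume "reverse_dart (?f t True) \<in> P"
      then obtain c' where c': "c' \<in> ?C" "reverse_dart (?f t True) = ?f (h c') False" unfolding P_def by blast
      have "c' \<in> {1..n}" using c'(1) by blast
      then have h': "h c' < ?N" "cr (h c') = c'" using hc(1,2) by blast+
      have "t = (h c' + ?N - 1) mod ?N" using c'(2) by (simp add: reverse_dart_def dart_from_def)
      then have "Suc t mod ?N = h c'" using Suc_pred_mod[OF h'(1)] by simp
      moreover have "h c' \<noteq> s" using h'(2) s(2) c'(1) by force
      ultimately have "r (h c') = Suc (r t)" using r_Suc[OF tN] by simp
      moreover have "\<mu> (reverse_dart (?f t True)) = ?N - r (h c')" unfolding c'(2) by (rule \<mu>f[OF h'(1)])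
      moreover have "\<mu> d = ?N - r ?t" unfolding d by (rule \<mu>f[OF t(1)])
      ultimately show "\<mu> (reverse_dart (?f t True)) < \<mu> d" using rt r_less[OF t(1)] by linarith
    qed
    have "?f (opp ?t) False \<notin> P"
    proof
      assume "?f (opp ?t) False \<in> P"
      then obtain c' where c': "c' \<in> ?C" "?f (opp ?t) False = ?f (h c') False" unfolding P_def by blast
      then have c'1: "c' \<in> {1..n}" by blast
      have "opp ?t = h c'" by (rule f_eq[OF c'(2) opp(1)[OF t(1)] hc(1)[OF c'1]])
      then have "r (opp ?t) < r ?t" using hc(3)[OF c'1] opp(2)[OF t(1)] by metis
      then show False using t by simp
    qed
    moreover have "e = ?f (opp ?t) True \<or> e = ?f (opp ?t) False \<or> e = ?f ?t True"
    proof -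
      have "\<rho> (?f ?t b) = ?f (opp ?t) True \<or> \<rho> (?f ?t b) = ?f (opp ?t) False" for b
        using \<rho>f[OF t(1), of b] by (metis (full_types))
      moreover have "\<rho> (\<rho> d) = ?f ?t True" using \<rho>2[OF t(1), of False] by (simp add: d)
      ultimately show ?thesis using e unfolding d by (metis empty_iff insert_iff)
    qed
    moreover have "?f t True \<notin> P" "reverse_dart (?f t False) \<notin> P" for t
      using PF by (force simp: dart_from_def reverse_dart_def)+
    ultimately show ?thesis using out[of ?t] out[of "opp ?t"] t opp(1)[OF t(1)] by auto
  qed
  have conn: "c d = c d'"
    if c: "\<And>d. d \<in> ?D \<Longrightarrow> c (\<phi> d) = c d \<and> c (reverse_dart d) = c d" and d: "d \<in> ?D" "d' \<in> ?D"
    for c :: "nat \<times> bool \<Rightarrow> (nat \<times> bool) set" and d d'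
  proof -
    have c\<rho>: "c (\<rho> d) = c d" if "d \<in> ?D" for d using c[OF that] c[OF rev(1)[OF that]] by (simp add: \<rho>_def)
    \<comment> \<open>Going straight through every crossing, as two quarter turns do, the knot
      itself runs through all edges.\<close>
    have base: "c (t, b) = c (0, True)" if "t < ?N" for t b
      using that
    proof (induction t arbitrary: b)
      case 0
      then show ?case using c[of "(0, True)"] by (cases b) (auto simp: reverse_dart_def)
    next
      case (Suc t)
      have "c (?f (Suc t) True) = c (?f (Suc t) False)"
        using \<rho>2[OF Suc.prems, of False] c\<rho>[OF fD[OF Suc.prems], of False] c\<rho>[OF \<rho>D[OF fD[OF Suc.prems]], of False]
        by simp
      then have "c (Suc t, True) = c (t, False)" using Suc.prems by (simp add: dart_from_def)
      then show ?case using c[of "(Suc t, True)"] Suc by (cases b) (auto simp: reverse_dart_def)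
    qed
    then show ?thesis using d by (metis SigmaE lessThan_iff)
  qed
  have "w (?f s True) \<otimes> (w (\<rho> (?f s True)) \<otimes> (w (\<rho> (\<rho> (?f s True))) \<otimes> w (\<rho> (\<rho> (\<rho> (?f s True)))))) = \<one>"
  proof (rule planar_holonomy[where D = ?D and P = P and E = E and \<phi> = \<phi> and \<alpha> = reverse_dart and \<rho> = \<rho> and w = w and \<mu> = \<mu>])
    show "finite ?D" by simp
    show "reverse_dart \<in> ?D \<rightarrow> ?D" using rev by blast
    show "E \<subseteq> ?D" by (auto simp: E_def)
    show "d \<in> P \<or> reverse_dart d \<in> P \<or> d \<in> E \<or> reverse_dart d \<in> E" if "d \<in> ?D" for d
      using rev[OF that] that by (cases "snd d") (auto simp: E_def reverse_dart_def)
    show "w d \<otimes> (w (\<rho> d) \<otimes> (w (\<rho> (\<rho> d)) \<otimes> w (\<rho> (\<rho> (\<rho> d))))) = \<one>" if dP: "d \<in> P" for d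
    proof -
      obtain c where c: "c \<in> ?C" "d = ?f (h c) False" using dP unfolding P_def by blast
      then have "c \<in> {1..n}" by blast
      then show ?thesis using hol[OF hc(1) c(2)] hc(2) rel[OF c(1)] by metis
    qed
  qed (rule \<rho>_def w(2) | fact \<phi>D inj rev(2) \<rho>4 w(1) P card \<mu> conn fD[OF s(1)])+
  then show ?thesis using hol[OF s(1) HOL.refl, of True] s(2) by simp
qed

section \<open>Trace-free matrices\<close>

definition sl :: "complex^3 \<Rightarrow> complex^2^2" where
  "sl v = vector [vector [v $ 1, v $ 2], vector [v $ 3, - v $ 1]]"

definition form :: "complex^3 \<Rightarrow> complex^3 \<Rightarrow> complex" where
  "form v w = - (2 * v $ 1 * w $ 1 + v $ 2 * w $ 3 + v $ 3 * w $ 2)"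

text \<open>The determinant of the three coordinate vectors.\<close>

definition volume :: "complex^3 \<Rightarrow> complex^3 \<Rightarrow> complex^3 \<Rightarrow> complex" where
  "volume u v w = u $ 1 * (v $ 2 * w $ 3 - v $ 3 * w $ 2) + u $ 2 * (v $ 3 * w $ 1 - v $ 1 * w $ 3)
    + u $ 3 * (v $ 1 * w $ 2 - v $ 2 * w $ 1)"

text \<open>The Leibniz formula with free rows and columns, so that relations between minors become
  plain polynomial identities.\<close>

definition minor3 :: "('i \<Rightarrow> 'j \<Rightarrow> complex) \<Rightarrow> 'i \<Rightarrow> 'i \<Rightarrow> 'i \<Rightarrow> 'j \<Rightarrow> 'j \<Rightarrow> 'j \<Rightarrow> complex" where
  "minor3 p a b c a' b' c' =
     p a a' * p b b' * p c c' + p a b' * p b c' * p c a' + p a c' * p b a' * p c b'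
     - p a a' * p b c' * p c b' - p a b' * p b a' * p c c' - p a c' * p b b' * p c a'"

lemma det_minor3:
  "det (vector [vector [p a a', p a b', p a c'], vector [p b a', p b b', p b c'],
      vector [p c a', p c b', p c c']] :: complex^3^3) = minor3 p a b c a' b' c'"
  by (simp add: det_3 minor3_def)

lemma trace_2: "trace (A :: complex^2^2) = A $ 1 $ 1 + A $ 2 $ 2"
  by (simp add: trace_def sum_2)

lemma matrix_mult_2: "((A :: complex^2^2) ** B) $ i $ j = A $ i $ 1 * B $ 1 $ j + A $ i $ 2 * B $ 2 $ j"
  by (simp add: matrix_matrix_mult_def sum_2)

lemma mat2_eq_iff: "(A :: complex^2^2) = B \<longleftrightarrow>
    A $ 1 $ 1 = B $ 1 $ 1 \<and> A $ 1 $ 2 = B $ 1 $ 2 \<and> A $ 2 $ 1 = B $ 2 $ 1 \<and> A $ 2 $ 2 = B $ 2 $ 2"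
  by (auto simp: vec_eq_iff forall_2)

lemma sl_simps: "sl v $ 1 $ 1 = v $ 1" "sl v $ 1 $ 2 = v $ 2" "sl v $ 2 $ 1 = v $ 3" "sl v $ 2 $ 2 = - v $ 1"
  by (simp_all add: sl_def)

lemma trace_free_eq_sl:
  assumes "trace A = 0" shows "\<exists>v. A = sl v"
  using assms
  by (intro exI[of _ "vector [A $ 1 $ 1, A $ 1 $ 2, A $ 2 $ 1]"])
    (simp add: mat2_eq_iff sl_simps trace_2 add_eq_0_iff)

lemma trace_sl: "trace (sl v) = 0"
  and det_sl: "det (sl v) = form v v / 2"
  and trace_sl2: "trace (sl v ** sl w) = - form v w"
  and trace_sl3: "trace (sl u ** sl v ** sl w) = volume u v w"
  by (simp_all add: trace_2 det_2 matrix_mult_2 sl_simps form_def volume_def field_simps)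

lemma form_linear [simp]:
  "form (u + v) w = form u w + form v w" "form w (u + v) = form w u + form w v"
  "form (c *s v) w = c * form v w" "form w (c *s v) = c * form w v"
  "form 0 w = 0" "form w 0 = 0"
  by (simp_all add: form_def algebra_simps)

lemma form_sym: "form v w = form w v"
  by (simp add: form_def algebra_simps)

lemma volume_uminus: "volume (- u) (- v) (- w) = - volume u v w"
  by (simp add: volume_def algebra_simps)

text \<open>Multiplicativity of the determinant: the matrix of \<open>form\<close> in these
  coordinates has determinant 2.\<close>

lemma volume_mult:
  "volume (v a) (v b) (v c) * volume (w a') (w b') (w c') =
    1 / 2 * minor3 (\<lambda>i j. form (v i) (w j)) a b c a' b' c'"
proof -
  have "2 * (volume (v a) (v b) (v c) * volume (w a') (w b') (w c')) =
      minor3 (\<lambda>i j. form (v i) (w j)) a b c a' b' c'"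
    unfolding volume_def minor3_def form_def by algebra
  then show ?thesis by (simp add: mult_ac)
qed

section \<open>Gram matrices and the minors in (GH)\<close>

lemma ex_gram3:
  fixes x y z :: complex
  shows "\<exists>u v w. form u u = 2 \<and> form v v = 2 \<and> form w w = 2 \<and> form u v = x \<and> form u w = y \<and> form v w = z"
proof -
  \<comment> \<open>\<open>u = (\<i>, 0, 0)\<close> has square 2, and its complement is the
    hyperbolic plane of the last two coordinates. Products with \<open>u\<close> fix the first
    coordinates of \<open>v\<close> and \<open>w\<close>; \<open>P\<close>, \<open>Q\<close>,
    \<open>R\<close> are the products left for their projections to that plane.\<close>
  define P Q R where "P = 2 - x * x / 2" and "Q = z - x * y / 2" and "R = 2 - y * y / 2"
  have "\<exists>b2 c2 b3 c3. 2 * b2 * c2 = - P \<and> 2 * b3 * c3 = - R \<and> b2 * c3 + c2 * b3 = - Q"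
  proof (cases "P = 0")
    case True
    then show ?thesis by (intro exI[of _ 0] exI[of _ "- Q"] exI[of _ 1] exI[of _ "- R / 2"]) simp
  next
    case False
    \<comment> \<open>With \<open>b2 = 1\<close> the system reduces to a quadratic equation for
      \<open>b3\<close>, solved by a complex square root.\<close>
    define s where "s = csqrt (Q\<^sup>2 - P * R)"
    have s: "s * s = Q * Q - P * R" by (metis power2_csqrt power2_eq_square s_def)
    define t where "t = (Q + s) / P"
    have "P * t = Q + s" using False by (simp add: t_def)
    then have "(P * t - Q) * (P * t - Q) = Q * Q - P * R" using s by simp
    then have "P * (P * t * t - 2 * Q * t + R) = 0" by (simp add: algebra_simps)
    then have "P * t * t - 2 * Q * t + R = 0" using False by simp
    then have "2 * t * (P * t / 2 - Q) = - R" by (simp add: algebra_simps add_eq_0_iff2)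
    then show ?thesis
      by (intro exI[of _ 1] exI[of _ "- P / 2"] exI[of _ t] exI[of _ "P * t / 2 - Q"]) simp
  qed
  then obtain b2 c2 b3 c3 where *: "2 * b2 * c2 = - P" "2 * b3 * c3 = - R" "b2 * c3 + c2 * b3 = - Q"
    by blast
  have "b2 * c2 = - P / 2" "b3 * c3 = - R / 2" using * by (simp_all add: field_simps)
  then show ?thesis using *(3)
    by (intro exI[of _ "vector [\<i>, 0, 0]"] exI[of _ "vector [\<i> * x / 2, b2, c2]"]
        exI[of _ "vector [\<i> * y / 2, b3, c3]"])
      (simp add: form_def P_def Q_def R_def field_simps)
qed

text \<open>(GH) speaks of increasing indices only. Adjacent swaps sort any triple, and a repeated
  index gives 0 because 2 is invertible.\<close>

lemma alternating_eq_0: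
  fixes f :: "nat \<Rightarrow> nat \<Rightarrow> nat \<Rightarrow> complex"
  assumes "\<And>a b c. f a b c = - f b a c" "\<And>a b c. f a b c = - f a c b"
    and sorted: "\<And>a b c. 1 \<le> a \<Longrightarrow> a < b \<Longrightarrow> b < c \<Longrightarrow> c \<le> n \<Longrightarrow> f a b c = 0"
    and range: "a \<in> {1..n}" "b \<in> {1..n}" "c \<in> {1..n}"
  shows "f a b c = 0"
proof -
  have 1: "f a b c = 0 \<longleftrightarrow> f b a c = 0" "f a b c = 0 \<longleftrightarrow> f a c b = 0" for a b c
    using assms(1)[of a b c] assms(2)[of a b c] by auto
  have 2: "f a a c = 0" "f a c c = 0" for a c
    using assms(1)[of a a c] assms(2)[of a c c] by auto
  have le: "f a b c = 0" if "1 \<le> a" "a \<le> b" "b \<le> c" "c \<le> n" for a b c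
    using that sorted[of a b c] 2 by (cases "a = b \<or> b = c") auto
  consider "a \<le> b \<and> b \<le> c" | "a \<le> c \<and> c \<le> b" | "b \<le> a \<and> a \<le> c" | "b \<le> c \<and> c \<le> a"
    | "c \<le> a \<and> a \<le> b" | "c \<le> b \<and> b \<le> a" by linarith
  then show ?thesis
    using range le[of a b c] le[of a c b] le[of b a c] le[of b c a] le[of c a b] le[of c b a]
    by cases (use 1 in \<open>auto; metis\<close>)+
qed

lemma minor3_swap:
  "minor3 p a b c a' b' c' = - minor3 p b a c a' b' c'" "minor3 p a b c a' b' c' = - minor3 p a c b a' b' c'"
  "minor3 p a b c a' b' c' = - minor3 p a b c b' a' c'" "minor3 p a b c a' b' c' = - minor3 p a b c a' c' b'"
  by (simp_all add: minor3_def algebra_simps)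

text \<open>\<open>e a b\<close> is the \<open>4 \<times> 4\<close> minor with rows \<open>i, j, k, a\<close> and columns \<open>i, j, k, b\<close>,
  expanded along its last row and column.\<close>

lemma sylvester_identity:
  fixes p :: "'i \<Rightarrow> 'i \<Rightarrow> complex" and i j k :: 'i
  defines "d \<equiv> minor3 p i j k i j k"
  defines "e \<equiv> \<lambda>a b. d * p a b
    - (p a i * ((p j j * p k k - p j k * p k j) * p i b - (p i j * p k k - p i k * p k j) * p j b
          + (p i j * p j k - p i k * p j j) * p k b)
     + p a j * (- (p j i * p k k - p j k * p k i) * p i b + (p i i * p k k - p i k * p k i) * p j b
          - (p i i * p j k - p i k * p j i) * p k b)
     + p a k * ((p j i * p k j - p j j * p k i) * p i b - (p i i * p k j - p i j * p k i) * p j b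
          + (p i i * p j j - p i j * p j i) * p k b))"
  shows "e a b * (p j j * p k k - p j k * p k j) =
      d * minor3 p a j k b j k - minor3 p a j k i j k * minor3 p i j k b j k"
    and "e a b * - (p j i * p k k - p j k * p k i) =
      d * minor3 p a j k i b k - minor3 p a j k i j k * minor3 p i j k i b k"
    and "e a b * (p j i * p k j - p j j * p k i) =
      d * minor3 p a j k i j b - minor3 p a j k i j k * minor3 p i j k i j b"
  unfolding e_def d_def minor3_def by algebra+

definition minors_factor ::
    "nat \<Rightarrow> (nat \<Rightarrow> nat \<Rightarrow> complex) \<Rightarrow> (nat \<Rightarrow> nat \<Rightarrow> nat \<Rightarrow> complex) \<Rightarrow> bool" where
  "minors_factor n p y \<longleftrightarrow> (\<forall>i j k i' j' k'.
     1 \<le> i \<and> i < j \<and> j < k \<and> k \<le> n \<and> 1 \<le> i' \<and> i' < j' \<and> j' < k' \<and> k' \<le> n \<longrightarrow>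
     y i j k * y i' j' k' = 1 / 2 * minor3 p i j k i' j' k')"

lemma minors_factorD:
  "minors_factor n p y \<Longrightarrow> 1 \<le> i \<Longrightarrow> i < j \<Longrightarrow> j < k \<Longrightarrow> k \<le> n \<Longrightarrow>
    1 \<le> i' \<Longrightarrow> i' < j' \<Longrightarrow> j' < k' \<Longrightarrow> k' \<le> n \<Longrightarrow>
    y i j k * y i' j' k' = 1 / 2 * minor3 p i j k i' j' k'"
  by (simp add: minors_factor_def)

text \<open>For increasing indices both sides are the same product of values of \<open>y\<close>.
  Their difference is alternating in the rows and in the columns, which covers all other
  indices.\<close>

lemma minors_rank_one:
  fixes p :: "nat \<Rightarrow> nat \<Rightarrow> complex"
  assumes factor: "minors_factor n p y"
    and I: "1 \<le> i" "i < j" "j < k" "k \<le> n"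
    and range: "a \<in> {1..n}" "b \<in> {1..n}" "c \<in> {1..n}" "a' \<in> {1..n}" "b' \<in> {1..n}" "c' \<in> {1..n}"
  shows "minor3 p i j k i j k * minor3 p a b c a' b' c' = minor3 p a b c i j k * minor3 p i j k a' b' c'"
proof -
  note GH = minors_factorD[OF factor]
  let ?f = "\<lambda>a b c a' b' c'. minor3 p i j k i j k * minor3 p a b c a' b' c' - minor3 p a b c i j k * minor3 p i j k a' b' c'"
  have swap: "?f a b c a' b' c' = - ?f b a c a' b' c'" "?f a b c a' b' c' = - ?f a c b a' b' c'"
    "?f a b c a' b' c' = - ?f a b c b' a' c'" "?f a b c a' b' c' = - ?f a b c a' c' b'" for a b c a' b' c'
    using minor3_swap[of p a b c] minor3_swap(3,4)[of p i j k] by (simp_all add: minor3_def algebra_simps)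
  have G: "minor3 p a b c a' b' c' = 2 * (y a b c * y a' b' c')"
    if "1 \<le> a" "a < b" "b < c" "c \<le> n" "1 \<le> a'" "a' < b'" "b' < c'" "c' \<le> n" for a b c a' b' c'
    unfolding GH[OF that] by simp
  have sorted: "?f a b c a' b' c' = 0"
    if "1 \<le> a" "a < b" "b < c" "c \<le> n" "1 \<le> a'" "a' < b'" "b' < c'" "c' \<le> n" for a b c a' b' c'
    using G[OF I I] G[OF I that(5-8)] G[OF that(1-4) I] G[OF that] by simp
  have half: "?f a b c a' b' c' = 0" if "1 \<le> a'" "a' < b'" "b' < c'" "c' \<le> n" for a' b' c'
    using alternating_eq_0[where f = "\<lambda>a b c. ?f a b c a' b' c'", OF swap(1,2) sorted[OF _ _ _ _ that] range(1-3)] .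
  have "?f a b c a' b' c' = 0"
    using alternating_eq_0[where f = "\<lambda>a' b' c'. ?f a b c a' b' c'", OF swap(3,4) half range(4-6)] .
  then show ?thesis by simp
qed

text \<open>The vectors are given by their products with one, two or three of them that span a
  nondegenerate subspace, namely as combinations of the dual basis \<open>N1\<close>, \<open>N2\<close>, \<open>N3\<close>.\<close>

lemma gram_vectors:
  fixes p :: "nat \<Rightarrow> nat \<Rightarrow> complex"
  assumes n: "n \<ge> 1" and diag: "\<And>i. p i i = 2" and sym: "\<And>i j. p i j = p j i"
    and factor: "minors_factor n p y"
  obtains v N1 N2 N3 b1 b2 b3 where
    "\<And>a. v a = p a b1 *s N1 + p a b2 *s N2 + p a b3 *s N3"
    "b1 \<in> {1..n}" "b2 \<in> {1..n}" "b3 \<in> {1..n}"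
    "\<And>a b. a \<in> {1..n} \<Longrightarrow> b \<in> {1..n} \<Longrightarrow> form (v a) (v b) = p a b"
proof -
  note GH = minors_factorD[OF factor]
  show ?thesis
  \<comment> \<open>The cases are rank 3, 2 and 1; in each, a nonzero principal minor of that size
    makes the span nondegenerate.\<close>
  proof (cases "\<exists>i j k. 1 \<le> i \<and> i < j \<and> j < k \<and> k \<le> n \<and> y i j k \<noteq> 0")
    case True
    then obtain i j k where I: "1 \<le> i" "i < j" "j < k" "k \<le> n" and nz: "y i j k \<noteq> 0" by blast
    have rI: "i \<in> {1..n}" "j \<in> {1..n}" "k \<in> {1..n}" using I by auto
    obtain u v w where uvw: "form u u = 2" "form v v = 2" "form w w = 2"
      "form u v = p i j" "form u w = p i k" "form v w = p j k"
      using ex_gram3 by blast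
    have uvw': "form v u = p i j" "form w u = p i k" "form w v = p j k"
      using uvw form_sym by metis+
    define x y' z where "x = p i j" and "y' = p i k" and "z = p j k"
    have p: "p i i = 2" "p j j = 2" "p k k = 2" "p i j = x" "p j i = x" "p i k = y'" "p k i = y'"
      "p j k = z" "p k j = z"
      using diag sym by (auto simp: x_def y'_def z_def)
    define d where "d = minor3 p i j k i j k"
    have "d = 2 * (y i j k * y i j k)" unfolding GH[OF I I] by (simp add: d_def)
    then have d0: "d \<noteq> 0" using nz by simp
    have d: "d = 8 + 2 * x * y' * z - 2 * x * x - 2 * y' * y' - 2 * z * z"
      by (simp add: d_def minor3_def p algebra_simps)
    \<comment> \<open>The coefficients are the rows of the adjugate of the Gram matrix of
      \<open>u\<close>, \<open>v\<close>, \<open>w\<close>; division by its determinant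
      \<open>d\<close> gives the dual basis.\<close>
    define U where "U = (4 - z * z) *s u + (y' * z - 2 * x) *s v + (x * z - 2 * y') *s w"
    define V where "V = (y' * z - 2 * x) *s u + (4 - y' * y') *s v + (x * y' - 2 * z) *s w"
    define W where "W = (x * z - 2 * y') *s u + (x * y' - 2 * z) *s v + (4 - x * x) *s w"
    have "form U U = (4 - z * z) * d" "form V V = (4 - y' * y') * d" "form W W = (4 - x * x) * d"
      "form U V = (y' * z - 2 * x) * d" "form U W = (x * z - 2 * y') * d" "form V W = (x * y' - 2 * z) * d"
      unfolding d U_def V_def W_def form_linear uvw uvw' p by algebra+
    moreover define q where "q = inverse d"
    moreover define N1 N2 N3 where "N1 = q *s U" and "N2 = q *s V" and "N3 = q *s W"
    ultimately have gram_N: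
      "form N1 N1 = q * (4 - z * z)" "form N2 N2 = q * (4 - y' * y')" "form N3 N3 = q * (4 - x * x)"
      "form N1 N2 = q * (y' * z - 2 * x)" "form N1 N3 = q * (x * z - 2 * y')" "form N2 N3 = q * (x * y' - 2 * z)"
      using d0 by simp_all
    have q: "q * d = 1" using d0 by (simp add: q_def)
    show ?thesis
    proof (rule that[OF HOL.refl rI])
      fix a b assume ab: "a \<in> {1..n}" "b \<in> {1..n}"
      \<comment> \<open>The bordered minor of \<open>sylvester_identity\<close>; it is
        \<open>d\<close> times the amount by which the constructed product misses
        \<open>p a b\<close>.\<close>
      define e where "e = d * p a b - (p a i * ((4 - z * z) * p i b + (y' * z - 2 * x) * p j b + (x * z - 2 * y') * p k b)
        + p a j * ((y' * z - 2 * x) * p i b + (4 - y' * y') * p j b + (x * y' - 2 * z) * p k b)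
        + p a k * ((x * z - 2 * y') * p i b + (x * y' - 2 * z) * p j b + (4 - x * x) * p k b))"
      note R = minors_rank_one[OF factor I]
      \<comment> \<open>The rank one relation says that the right-hand sides of Sylvester's identity
        vanish.\<close>
      have e_cof: "e * (4 - z * z) = 0" "e * (y' * z - 2 * x) = 0" "e * (x * z - 2 * y') = 0"
        using sylvester_identity[of p i j k a b] R[OF ab(1) rI(2,3) ab(2) rI(2,3)]
          R[OF ab(1) rI(2,3) rI(1) ab(2) rI(3)] R[OF ab(1) rI(2,3) rI(1,2) ab(2)]
        unfolding d_def[symmetric] p by (simp_all add: e_def algebra_simps)
      \<comment> \<open>Expansion of the determinant \<open>d\<close> along its first row.\<close>
      have "e * d = 2 * (e * (4 - z * z)) + x * (e * (y' * z - 2 * x)) + y' * (e * (x * z - 2 * y'))"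
        unfolding d by (simp add: algebra_simps)
      then have "e = 0" using e_cof d0 by simp
      have "form (p a i *s N1 + p a j *s N2 + p a k *s N3) (p b i *s N1 + p b j *s N2 + p b k *s N3) =
          q * (d * p a b - e)"
        unfolding form_linear gram_N form_sym[of N2 N1] form_sym[of N3 N1] form_sym[of N3 N2]
          e_def sym[of i b] sym[of j b] sym[of k b] by algebra
      also have "\<dots> = p a b" using q \<open>e = 0\<close> by (simp add: mult.assoc[symmetric])
      finally show "form (p a i *s N1 + p a j *s N2 + p a k *s N3) (p b i *s N1 + p b j *s N2 + p b k *s N3) = p a b" .
    qed
  next
    case False
    then have y0: "y i j k = 0" if "1 \<le> i" "i < j" "j < k" "k \<le> n" for i j k using that by blast
    have minor0: "minor3 p a b c a' b' c' = 0" if "a \<in> {1..n}" "b \<in> {1..n}" "c \<in> {1..n}"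
      "a' \<in> {1..n}" "b' \<in> {1..n}" "c' \<in> {1..n}" for a b c a' b' c'
    proof -
      have sorted: "minor3 p a b c a' b' c' = 0"
        if "1 \<le> a" "a < b" "b < c" "c \<le> n" "1 \<le> a'" "a' < b'" "b' < c'" "c' \<le> n" for a b c a' b' c'
        using GH[OF that] y0[OF that(1-4)] by simp
      have half: "minor3 p a b c a' b' c' = 0" if "1 \<le> a'" "a' < b'" "b' < c'" "c' \<le> n" for a' b' c'
        using alternating_eq_0[where f = "\<lambda>a b c. minor3 p a b c a' b' c'" and n = n,
            OF minor3_swap(1,2) sorted[OF _ _ _ _ that]] \<open>a \<in> {1..n}\<close> \<open>b \<in> {1..n}\<close> \<open>c \<in> {1..n}\<close> by blast
      show ?thesis
        using alternating_eq_0[where f = "\<lambda>a' b' c'. minor3 p a b c a' b' c'" and n = n, OF minor3_swap(3,4) half that(4-6)] .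
    qed
    show ?thesis
    proof (cases "\<exists>i\<in>{1..n}. \<exists>j\<in>{1..n}. p i j * p i j \<noteq> 4")
      case True
      then obtain i j where ij: "i \<in> {1..n}" "j \<in> {1..n}" and ne: "p i j * p i j \<noteq> 4" by blast
      define x D where "x = p i j" and "D = 4 - x * x"
      have D0: "D \<noteq> 0" using ne by (simp add: D_def x_def)
      obtain u w where uw: "form u u = 2" "form w w = 2" "form u w = x" using ex_gram3[of x] by blast
      define U where "U = 2 *s u + (- x) *s w"
      define W where "W = (- x) *s u + 2 *s w"
      have "form U U = 2 * D" "form W W = 2 * D" "form U W = - x * D"
        unfolding U_def W_def D_def form_linear uw form_sym[of w u] by algebra+
      moreover define q where "q = inverse D"
      moreover define N1 N2 where "N1 = q *s U" and "N2 = q *s W"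
      ultimately have gram_N: "form N1 N1 = q * 2" "form N2 N2 = q * 2" "form N1 N2 = q * - x"
        using D0 by simp_all
      have q: "q * D = 1" using D0 by (simp add: q_def)
      show ?thesis
      \<comment> \<open>Two vectors suffice here; the third summand pads to the common
        format.\<close>
      proof (rule that[of "\<lambda>a. p a i *s N1 + p a j *s N2 + p a i *s 0" i N1 j N2 i 0])
        fix a b assume ab: "a \<in> {1..n}" "b \<in> {1..n}"
        have "p i i = 2" "p j j = 2" "p i j = x" "p j i = x" using diag sym by (auto simp: x_def)
        \<comment> \<open>The vanishing minor with rows \<open>i, j, a\<close> and columns
          \<open>i, j, b\<close>, solved for its corner entry.\<close>
        then have D: "D * p a b = 2 * p a i * p b i + 2 * p a j * p b j - x * (p a i * p b j + p a j * p b i)"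
          using minor0[OF ij ab(1) ij ab(2)] sym[of i b] sym[of j b]
          by (simp add: minor3_def D_def algebra_simps)
        have "form (p a i *s N1 + p a j *s N2 + p a i *s 0) (p b i *s N1 + p b j *s N2 + p b i *s 0) = q * (D * p a b)"
          unfolding form_linear gram_N form_sym[of N2 N1] D by algebra
        also have "\<dots> = p a b" using q by (simp add: mult.assoc[symmetric])
        finally show "form (p a i *s N1 + p a j *s N2 + p a i *s 0) (p b i *s N1 + p b j *s N2 + p b i *s 0) = p a b" .
      qed (use ij in auto)
    next
      case False
      have one: "1 \<in> {1..n}" using n by simp
      obtain u where u: "form u u = 2" using ex_gram3 by blast
      show ?thesis
      proof (rule that[of "\<lambda>a. p a 1 *s ((1 / 2) *s u) + p a 1 *s 0 + p a 1 *s 0" 1 "(1 / 2) *s u" 1 0 1 0])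
        fix a b assume ab: "a \<in> {1..n}" "b \<in> {1..n}"
        have sq: "p 1 a * p 1 a = 4" "p 1 b * p 1 b = 4" "p a b * p a b = 4" using False ab one by blast+
        \<comment> \<open>The vanishing principal minor on \<open>1, a, b\<close>; it fixes the
          signs of the entries, all of which are 2 or -2.\<close>
        have "2 * (p 1 a * p 1 b * p a b) + 8 = 2 * (p 1 a * p 1 a) + 2 * (p 1 b * p 1 b) + 2 * (p a b * p a b)"
          using minor0[OF one ab one ab] sym[of a 1] sym[of b 1] sym[of b a] diag
          by (simp add: minor3_def algebra_simps)
        then have "p 1 a * p 1 b * p a b = 8" using sq by (simp add: mult_ac)
        then have "p 1 a * p 1 b * (p a b * p a b) = 8 * p a b" by (simp add: mult.assoc[symmetric])
        then have "p 1 a * p 1 b = 2 * p a b" unfolding sq by simp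
        then show "form (p a 1 *s ((1 / 2) *s u) + p a 1 *s 0 + p a 1 *s 0)
            (p b 1 *s ((1 / 2) *s u) + p b 1 *s 0 + p b 1 *s 0) = p a b"
          using sym[of a 1] sym[of b 1] u by (simp add: mult_ac)
      qed (use one in auto)
    qed
  qed
qed

text \<open>The Gram matrix determines the volumes up to one common sign, which negating every
  vector reverses. Relations between rows of \<open>p\<close> carry over because each vector is a
  fixed linear function of three entries of its row.\<close>

lemma gram_vectors_oriented:
  fixes p :: "nat \<Rightarrow> nat \<Rightarrow> complex"
  assumes n: "n \<ge> 1" and diag: "\<And>i. p i i = 2" and sym: "\<And>i j. p i j = p j i"
    and factor: "minors_factor n p y"
  obtains v :: "nat \<Rightarrow> complex^3" where
    "\<And>a b. a \<in> {1..n} \<Longrightarrow> b \<in> {1..n} \<Longrightarrow> form (v a) (v b) = p a b"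
    "\<And>i j k. 1 \<le> i \<Longrightarrow> i < j \<Longrightarrow> j < k \<Longrightarrow> k \<le> n \<Longrightarrow> volume (v i) (v j) (v k) = - y i j k"
    "\<And>i j k s. (\<forall>a\<in>{1..n}. p a k = s * p a i - p a j) \<Longrightarrow> v k = s *s v i - v j"
proof -
  note GH = minors_factorD[OF factor]
  obtain v N1 N2 N3 b1 b2 b3 where v: "\<And>a. v a = p a b1 *s N1 + p a b2 *s N2 + p a b3 *s N3"
    and b: "b1 \<in> {1..n}" "b2 \<in> {1..n}" "b3 \<in> {1..n}"
    and form: "\<And>a b. a \<in> {1..n} \<Longrightarrow> b \<in> {1..n} \<Longrightarrow> form (v a) (v b) = p a b"
    by (rule gram_vectors[OF n diag sym factor]) (rule that; assumption)
  have lin: "v k = s *s v i - v j" if "\<forall>a\<in>{1..n}. p a k = s * p a i - p a j" for i j k s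
  proof -
    have "p k b = s * p i b - p j b" if "b \<in> {1..n}" for b
      using \<open>\<forall>a\<in>{1..n}. p a k = s * p a i - p a j\<close> that sym by metis
    then have k: "p k b1 = s * p i b1 - p j b1" "p k b2 = s * p i b2 - p j b2" "p k b3 = s * p i b3 - p j b3"
      using b by blast+
    show ?thesis unfolding v k by (simp add: vec_eq_iff algebra_simps)
  qed
  have vol: "volume (v a) (v b) (v c) * volume (v a') (v b') (v c') = y a b c * y a' b' c'"
    if "1 \<le> a" "a < b" "b < c" "c \<le> n" "1 \<le> a'" "a' < b'" "b' < c'" "c' \<le> n" for a b c a' b' c'
    unfolding volume_mult GH[OF that] using that by (simp add: minor3_def form)
  define flip where "flip \<longleftrightarrow> (\<exists>a b c. 1 \<le> a \<and> a < b \<and> b < c \<and> c \<le> n \<and> volume (v a) (v b) (v c) \<noteq> - y a b c)"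
  define v' where "v' a = (if flip then - v a else v a)" for a
  have "volume (v' i) (v' j) (v' k) = - y i j k" if I: "1 \<le> i" "i < j" "j < k" "k \<le> n" for i j k
  proof (cases flip)
    case False
    then show ?thesis using I by (auto simp: flip_def v'_def)
  next
    case True
    then obtain a b c where A: "1 \<le> a" "a < b" "b < c" "c \<le> n" and ne: "volume (v a) (v b) (v c) \<noteq> - y a b c"
      by (auto simp: flip_def)
    \<comment> \<open>Volumes and values of \<open>y\<close> have equal squares. One volume other
      than \<open>- y\<close> is therefore \<open>y\<close> and nonzero, and its products with the
      others fix all their signs.\<close>
    have "(volume (v a) (v b) (v c) - y a b c) * (volume (v a) (v b) (v c) + y a b c) = 0"
      using vol[OF A A] by (simp add: algebra_simps)
    then have eq: "volume (v a) (v b) (v c) = y a b c" using ne by (auto simp: add_eq_0_iff)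
    then have "y a b c \<noteq> 0" using ne by auto
    then have "volume (v i) (v j) (v k) = y i j k" using vol[OF A I] eq by simp
    then show ?thesis using True by (simp add: v'_def volume_uminus)
  qed
  moreover have "form (- u) (- w) = form u w" for u w by (simp add: form_def)
  then have "form (v' a) (v' b) = p a b" if "a \<in> {1..n}" "b \<in> {1..n}" for a b
    using form that by (simp add: v'_def)
  moreover have "v' k = s *s v' i - v' j" if "\<forall>a\<in>{1..n}. p a k = s * p a i - p a j" for i j k s
    using lin[OF that] by (auto simp: v'_def vec_eq_iff)
  ultimately show ?thesis using that by blast
qed

section \<open>Representations of groups given by presentations\<close>

lemma eval_word_Nil [simp]: "eval_word G x [] = \<one>\<^bsub>G\<^esub>"
  and eval_word_Cons: "eval_word G x (l # w) =
    (if snd l then x (fst l) else inv\<^bsub>G\<^esub> (x (fst l))) \<otimes>\<^bsub>G\<^esub> eval_word G x w"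
  by (simp_all add: eval_word_def split: prod.splits)

lemma (in group) eval_word_closed:
  assumes "x \<in> X \<rightarrow> carrier G" "w \<in> lists (X \<times> UNIV)"
  shows "eval_word G x w \<in> carrier G"
  using assms(2)
proof induction
  case (Cons l w)
  then have "x (fst l) \<in> carrier G" using assms(1) by auto
  then show ?case using Cons by (simp add: eval_word_Cons)
qed simp

lemma (in group) eval_word_append:
  assumes x: "x \<in> X \<rightarrow> carrier G" and u: "u \<in> lists (X \<times> UNIV)" and v: "v \<in> lists (X \<times> UNIV)"
  shows "eval_word G x (u @ v) = eval_word G x u \<otimes> eval_word G x v"
  using u
proof induction
  case Nil
  then show ?case using eval_word_closed[OF x v] by simp
next
  case (Cons l w)
  then have "x (fst l) \<in> carrier G" using x by auto
  then show ?case
    using Cons eval_word_closed[OF x] v by (simp add: eval_word_Cons m_assoc)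
qed

lemma (in group) eval_word_eq:
  assumes "word_eq X R v w" and x: "x \<in> X \<rightarrow> carrier G"
    and R: "R \<subseteq> lists (X \<times> UNIV)" "\<And>r. r \<in> R \<Longrightarrow> eval_word G x r = \<one>"
  shows "eval_word G x v = eval_word G x w"
  using assms(1)
proof induction
  case (cancel u v i b)
  have xi: "x i \<in> carrier G" using cancel x by auto
  let ?r = "[(i, b), (i, \<not> b)]"
  have r: "?r \<in> lists (X \<times> UNIV)" using cancel by simp
  have "eval_word G x ?r = \<one>" using xi by (simp add: eval_word_Cons)
  moreover have "eval_word G x (u @ ?r @ v) = eval_word G x u \<otimes> (eval_word G x ?r \<otimes> eval_word G x v)"
    using eval_word_append[OF x cancel(1), of "?r @ v"] eval_word_append[OF x r cancel(2)] cancel r by simp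
  ultimately show ?case
    using cancel eval_word_closed[OF x cancel(2)] eval_word_append[OF x cancel(1,2)] by simp
next
  case (relator u v r)
  then have "r \<in> lists (X \<times> UNIV)" using R by blast
  then show ?case
    using relator R(2) eval_word_closed[OF x] by (simp add: eval_word_append[OF x])
qed auto

lemma presents_relator:
  assumes P: "presents G X x R" and r: "r \<in> R"
  shows "eval_word G x r = \<one>\<^bsub>G\<^esub>"
proof -
  have "word_eq X R ([] @ r @ []) ([] @ [])" by (rule word_eq.relator) (use r in auto)
  then have "word_eq X R r []" by simp
  moreover have "r \<in> lists (X \<times> UNIV)" "[] \<in> lists (X \<times> (UNIV :: bool set))"
    using P r by (auto simp: presents_def)
  ultimately have "eval_word G x r = eval_word G x []" using P unfolding presents_def by blast
  then show ?thesis by simp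
qed

text \<open>Von Dyck's theorem: any word for an element may be used, since two of them are related
  by \<open>word_eq\<close>, which evaluation in \<open>H\<close> respects.\<close>

lemma presents_hom:
  assumes G: "group G" and H: "group H" and P: "presents G X x R" and y: "y \<in> X \<rightarrow> carrier H"
    and rel: "\<And>r. r \<in> R \<Longrightarrow> eval_word H y r = \<one>\<^bsub>H\<^esub>"
  obtains \<rho> where "\<rho> \<in> hom G H" "\<And>i. i \<in> X \<Longrightarrow> \<rho> (x i) = y i"
proof -
  interpret G: group G by (rule G)
  interpret H: group H by (rule H)
  let ?L = "lists (X \<times> (UNIV :: bool set))"
  have x: "x \<in> X \<rightarrow> carrier G" and R: "R \<subseteq> ?L" and surj: "eval_word G x ` ?L = carrier G"
    and eq: "\<And>v w. v \<in> ?L \<Longrightarrow> w \<in> ?L \<Longrightarrow> eval_word G x v = eval_word G x w \<longleftrightarrow> word_eq X R v w"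
    using P unfolding presents_def by blast+
  define \<rho> where "\<rho> g = eval_word H y (SOME w. w \<in> ?L \<and> eval_word G x w = g)" for g
  have \<rho>: "\<rho> (eval_word G x w) = eval_word H y w" if w: "w \<in> ?L" for w
  proof -
    let ?v = "SOME v. v \<in> ?L \<and> eval_word G x v = eval_word G x w"
    have v: "?v \<in> ?L \<and> eval_word G x ?v = eval_word G x w" by (rule someI[of _ w]) (use w in simp)
    then have "word_eq X R ?v w" using eq w by blast
    then show ?thesis unfolding \<rho>_def by (rule H.eval_word_eq[OF _ y R rel])
  qed
  have "\<rho> \<in> hom G H"
  proof (rule homI)
    fix g assume "g \<in> carrier G"
    then obtain w where "w \<in> ?L" "g = eval_word G x w" using surj by blast
    then show "\<rho> g \<in> carrier H" using \<rho> H.eval_word_closed[OF y] by simp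
  next
    fix g g' assume "g \<in> carrier G" "g' \<in> carrier G"
    then obtain w w' where w: "w \<in> ?L" "g = eval_word G x w" "w' \<in> ?L" "g' = eval_word G x w'"
      using surj by blast
    then have "g \<otimes>\<^bsub>G\<^esub> g' = eval_word G x (w @ w')" by (simp add: G.eval_word_append[OF x])
    then show "\<rho> (g \<otimes>\<^bsub>G\<^esub> g') = \<rho> g \<otimes>\<^bsub>H\<^esub> \<rho> g'"
      using w \<rho>[of "w @ w'"] by (simp add: \<rho> H.eval_word_append[OF y])
  qed
  moreover have "\<rho> (x i) = y i" if "i \<in> X" for i
  proof -
    have "x i \<in> carrier G" "y i \<in> carrier H" using that x y by auto
    then have "eval_word G x [(i, True)] = x i" "eval_word H y [(i, True)] = y i"
      by (simp_all add: eval_word_Cons)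
    then show ?thesis using \<rho>[of "[(i, True)]"] that by simp
  qed
  ultimately show ?thesis using that by blast
qed

lemma hom_eval_word:
  assumes G: "group G" and H: "group H" and \<rho>: "\<rho> \<in> hom G H" and x: "x \<in> X \<rightarrow> carrier G"
    and w: "w \<in> lists (X \<times> UNIV)"
  shows "\<rho> (eval_word G x w) = eval_word H (\<rho> \<circ> x) w"
proof -
  interpret group_hom G H \<rho> using G H \<rho> by (simp add: group_hom_def group_hom_axioms_def)
  show ?thesis using w
  proof induction
    case (Cons l w)
    then have "x (fst l) \<in> carrier G" using x by auto
    then show ?case using Cons G.eval_word_closed[OF x] by (simp add: eval_word_Cons)
  qed simp
qed

section \<open>Trace-free representations in \<open>SL\<^sub>2\<close>\<close>

lemma SL2_simps [simp]: "carrier SL2 = {A. det A = 1}" "A \<otimes>\<^bsub>SL2\<^esub> B = A ** B" "\<one>\<^bsub>SL2\<^esub> = mat 1"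
  by (simp_all add: SL2_def)

lemma mat_2: "(mat k :: complex^2^2) $ i $ j = (if i = j then k else 0)"
  by (simp add: mat_def)

definition adjugate2 :: "complex^2^2 \<Rightarrow> complex^2^2" where
  "adjugate2 A = vector [vector [A $ 2 $ 2, - A $ 1 $ 2], vector [- A $ 2 $ 1, A $ 1 $ 1]]"

lemma adjugate2:
  assumes "det A = 1"
  shows "adjugate2 A ** A = mat 1" "A ** adjugate2 A = mat 1" "det (adjugate2 A) = 1"
    "trace (adjugate2 A) = trace A"
  using assms
  by (simp_all add: adjugate2_def mat2_eq_iff matrix_mult_2 mat_2 det_2 trace_2 algebra_simps)

lemma SL2_group: "group SL2"
proof (rule groupI)
  fix A assume "A \<in> carrier SL2"
  then show "\<exists>B\<in>carrier SL2. B \<otimes>\<^bsub>SL2\<^esub> A = \<one>\<^bsub>SL2\<^esub>"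
    using adjugate2[of A] by (intro bexI[of _ "adjugate2 A"]) auto
qed (auto simp: det_mul matrix_mul_assoc)

lemma trace_inverse_SL2:
  assumes "A ** B = mat 1" "det B = 1"
  shows "trace A = trace (B :: complex^2^2)"
proof -
  have "A = A ** (B ** adjugate2 B)" using adjugate2(2)[OF assms(2)] by simp
  also have "\<dots> = adjugate2 B" using assms(1) by (simp add: matrix_mul_assoc)
  finally show ?thesis using adjugate2(4)[OF assms(2)] by simp
qed

lemma trace_conjugate_SL2:
  assumes "A ** C = C ** B" "det C = 1"
  shows "trace A = trace (B :: complex^2^2)"
proof -
  have "trace A = trace (A ** (C ** adjugate2 C))" using adjugate2(2)[OF assms(2)] by simp
  also have "\<dots> = trace (C ** B ** adjugate2 C)" by (simp add: matrix_mul_assoc assms(1))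
  also have "\<dots> = trace (adjugate2 C ** (C ** B))" by (rule trace_mul_sym)
  also have "\<dots> = trace B" using adjugate2(1)[OF assms(2)] by (simp add: matrix_mul_assoc)
  finally show ?thesis .
qed

lemma sl_inject: "sl v = sl w \<longleftrightarrow> v = w"
  by (auto simp: mat2_eq_iff sl_simps vec_eq_iff forall_3)

text \<open>\<open>sl u\<close> squares to -1, so conjugation by it and by its inverse coincide;
  hence positive and negative crossings lead to the same equation.\<close>

lemma sl_conjugate_iff:
  assumes u: "form u u = 2"
  shows "sl u ** sl w = sl v ** sl u \<longleftrightarrow> w = form u v *s u - v"
    and "sl w ** sl u = sl u ** sl v \<longleftrightarrow> w = form u v *s u - v"
proof -
  have u': "u $ 1 * u $ 1 + u $ 2 * u $ 3 = - 1"
  proof -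
    have "- 2 * (u $ 1 * u $ 1 + u $ 2 * u $ 3) = 2" using u by (simp add: form_def algebra_simps)
    then have "u $ 1 * u $ 1 + u $ 2 * u $ 3 = 2 / - 2" by (metis div_by_0 neg_equal_0_iff_equal nonzero_mult_div_cancel_left zero_neq_numeral)
    then show ?thesis by simp
  qed
  let ?w = "form u v *s u - v"
  have 1: "sl u ** sl ?w = sl v ** sl u" "sl ?w ** sl u = sl u ** sl v"
    unfolding mat2_eq_iff matrix_mult_2 sl_simps form_def
    using u' by (simp_all; algebra)+
  have d: "det (sl u) = 1" using u by (simp add: det_sl)
  have "w = ?w" if "sl u ** sl w = sl v ** sl u"
  proof -
    have "adjugate2 (sl u) ** (sl u ** sl w) = adjugate2 (sl u) ** (sl u ** sl ?w)" using that 1 by simp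
    then show ?thesis using adjugate2(1)[OF d] by (simp add: matrix_mul_assoc sl_inject)
  qed
  then show "sl u ** sl w = sl v ** sl u \<longleftrightarrow> w = ?w" using 1 by blast
  have "w = ?w" if "sl w ** sl u = sl u ** sl v"
  proof -
    have "(sl w ** sl u) ** adjugate2 (sl u) = (sl ?w ** sl u) ** adjugate2 (sl u)" using that 1 by simp
    then show ?thesis using adjugate2(2)[OF d] by (simp add: matrix_mul_assoc[symmetric] sl_inject)
  qed
  then show "sl w ** sl u = sl u ** sl v \<longleftrightarrow> w = ?w" using 1 by blast
qed

text \<open>The half turn about \<open>u\<close> is an involution, which allows the two underarcs of
  a crossing to be exchanged.\<close>

lemma half_turn_sym:
  assumes u: "form u u = 2"
  shows "w = form u v *s u - v \<longleftrightarrow> v = form u w *s u - w"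
proof -
  have "v = form u w *s u - w" if "w = form u v *s u - v" for v w
  proof -
    have "form u (a - b) = form u a - form u b" for a b by (simp add: form_def algebra_simps)
    then have "form u w = form u v" using u unfolding that by simp
    then show ?thesis using that by simp
  qed
  then show ?thesis by blast
qed

text \<open>Without inverses, the relators become equations between products of two matrices, as in
  \<open>sl_conjugate_iff\<close>.\<close>

lemma (in group) conjugation_relators:
  assumes c: "i \<in> carrier G" "j \<in> carrier G" "k \<in> carrier G"
  shows "i \<otimes> (k \<otimes> (inv i \<otimes> inv j)) = \<one> \<longleftrightarrow> i \<otimes> k = j \<otimes> i"
    and "i \<otimes> (inv j \<otimes> (inv i \<otimes> k)) = \<one> \<longleftrightarrow> k \<otimes> i = i \<otimes> j"
proof -
  have "i \<otimes> (k \<otimes> (inv i \<otimes> inv j)) = (i \<otimes> k) \<otimes> inv (j \<otimes> i)"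
    using c by (simp add: inv_mult_group m_assoc)
  then show "i \<otimes> (k \<otimes> (inv i \<otimes> inv j)) = \<one> \<longleftrightarrow> i \<otimes> k = j \<otimes> i"
    using c by (metis inv_closed inv_solve_right l_one m_closed r_inv)
  have "i \<otimes> (inv j \<otimes> (inv i \<otimes> k)) = \<one> \<longleftrightarrow> inv j \<otimes> (inv i \<otimes> (k \<otimes> i)) = \<one>"
    using cyclic_product_eq_one[of i "inv j" "inv i" k] c by simp
  also have "inv j \<otimes> (inv i \<otimes> (k \<otimes> i)) = inv (i \<otimes> j) \<otimes> (k \<otimes> i)"
    using c by (simp add: inv_mult_group m_assoc)
  finally show "i \<otimes> (inv j \<otimes> (inv i \<otimes> k)) = \<one> \<longleftrightarrow> k \<otimes> i = i \<otimes> j"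
    using c by (metis inv_closed inv_solve_left m_closed r_one l_inv)
qed

lemma wirtinger_relator_SL2:
  assumes D: "knot_diagram n D" and c: "c \<in> {1..n}"
    and unit: "\<And>a. a \<in> {1..n} \<Longrightarrow> form (v a) (v a) = 2"
    and M: "\<And>a. a \<in> {1..n} \<Longrightarrow> M a = sl (v a)"
  defines "i \<equiv> arc_into D (Over c)" and "j \<equiv> arc_into D (Under c)"
  shows "eval_word SL2 M (wirtinger_relator D c) = \<one>\<^bsub>SL2\<^esub> \<longleftrightarrow> v c = form (v i) (v j) *s v i - v j"
proof -
  interpret SL2: group SL2 by (rule SL2_group)
  have ij: "i \<in> {1..n}" "j \<in> {1..n}" using arc_into_range[OF D] by (auto simp: i_def j_def)
  have cl: "M a \<in> carrier SL2" if "a \<in> {1..n}" for a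
    using unit[OF that] M[OF that] by (simp add: det_sl)
  note rel = SL2.conjugation_relators[OF cl[OF ij(1)] cl[OF ij(2)] cl[OF c]]
  have inv: "inv\<^bsub>SL2\<^esub> M a \<otimes>\<^bsub>SL2\<^esub> \<one>\<^bsub>SL2\<^esub> = inv\<^bsub>SL2\<^esub> M a" "M a \<otimes>\<^bsub>SL2\<^esub> \<one>\<^bsub>SL2\<^esub> = M a"
    if "a \<in> {1..n}" for a
    using cl[OF that] SL2.inv_closed by (intro SL2.r_one; simp)+
  show ?thesis
  proof (cases "positive D c")
    case True
    then have "eval_word SL2 M (wirtinger_relator D c) =
        M i \<otimes>\<^bsub>SL2\<^esub> (M c \<otimes>\<^bsub>SL2\<^esub> (inv\<^bsub>SL2\<^esub> M i \<otimes>\<^bsub>SL2\<^esub> inv\<^bsub>SL2\<^esub> M j))"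
      using inv(1)[OF ij(2)] by (simp add: wirtinger_relator_def Let_def i_def j_def eval_word_Cons del: SL2_simps)
    then show ?thesis
      using rel(1) sl_conjugate_iff(1)[OF unit[OF ij(1)], of "v c" "v j"] M[OF ij(1)] M[OF ij(2)] M[OF c] by simp
  next
    case False
    then have "eval_word SL2 M (wirtinger_relator D c) =
        M i \<otimes>\<^bsub>SL2\<^esub> (inv\<^bsub>SL2\<^esub> M j \<otimes>\<^bsub>SL2\<^esub> (inv\<^bsub>SL2\<^esub> M i \<otimes>\<^bsub>SL2\<^esub> M c))"
      using inv(2)[OF c] by (simp add: wirtinger_relator_def Let_def i_def j_def eval_word_Cons del: SL2_simps)
    then show ?thesis
      using rel(2) sl_conjugate_iff(2)[OF unit[OF ij(1)], of "v c" "v j"] M[OF ij(1)] M[OF ij(2)] M[OF c] by simp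
  qed
qed

section \<open>Polynomial maps\<close>

lemma polynomial_maps_diff:
  assumes "f \<in> polynomial_maps I" "g \<in> polynomial_maps I"
  shows "(\<lambda>x. f x - g x) \<in> polynomial_maps I"
proof -
  have "(\<lambda>x. f x + (- 1) * g x) \<in> polynomial_maps I"
    using assms by (intro polynomial_maps.intros)
  then show ?thesis by simp
qed

lemmas polynomial_intros = polynomial_maps.intros polynomial_maps_diff

lemma polynomial_maps_uminus_comp:
  assumes "f \<in> polynomial_maps I"
  shows "(\<lambda>x. f (\<lambda>i\<in>I. - x i)) \<in> polynomial_maps I"
  using assms
proof induction
  case (coordinate i)
  have "(\<lambda>x. (- 1) * x i) \<in> polynomial_maps I" using coordinate by (intro polynomial_maps.intros)
  then show ?case using coordinate by simp
qed (simp_all add: polynomial_maps.intros)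

text \<open>Negation is a polynomial involution, so \<open>S\<close> is the preimage of
  \<open>T\<close> and inherits algebraicity from it.\<close>

lemma algebraic_isomorphism_uminus:
  fixes S T :: "('v \<Rightarrow> complex) set" and I :: "'v set"
  defines "neg \<equiv> \<lambda>x. \<lambda>i\<in>I. - x i"
  assumes T: "algebraic_set I T" and ST: "neg \<in> S \<rightarrow> T" "neg \<in> T \<rightarrow> S" and S: "S \<subseteq> I \<rightarrow>\<^sub>E UNIV"
  shows "algebraic_isomorphism I S I T neg"
proof -
  obtain F where F: "F \<subseteq> polynomial_maps I" "T = {x \<in> I \<rightarrow>\<^sub>E UNIV. \<forall>f\<in>F. f x = 0}"
    using T unfolding algebraic_set_def by blast
  have inv: "neg (neg x) = x" if "x \<in> I \<rightarrow>\<^sub>E UNIV" for x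
  proof
    fix i
    show "neg (neg x) i = x i" using PiE_arb[OF that, of i] by (cases "i \<in> I") (simp_all add: neg_def)
  qed
  have negE: "neg x \<in> I \<rightarrow>\<^sub>E UNIV" for x by (simp add: neg_def)
  have "S = {x \<in> I \<rightarrow>\<^sub>E UNIV. neg x \<in> T}"
  proof (intro subset_antisym subsetI)
    fix x assume "x \<in> S"
    then show "x \<in> {x \<in> I \<rightarrow>\<^sub>E UNIV. neg x \<in> T}" using S funcset_mem[OF ST(1)] by blast
  next
    fix x assume "x \<in> {x \<in> I \<rightarrow>\<^sub>E UNIV. neg x \<in> T}"
    then show "x \<in> S" using inv funcset_mem[OF ST(2), of "neg x"] by simp
  qed
  then have "S = {x \<in> I \<rightarrow>\<^sub>E UNIV. \<forall>f \<in> (\<lambda>f x. f (neg x)) ` F. f x = 0}"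
    using negE unfolding F(2) by simp
  moreover have "(\<lambda>f x. f (neg x)) ` F \<subseteq> polynomial_maps I"
    unfolding neg_def using F(1) polynomial_maps_uminus_comp by blast
  ultimately have algS: "algebraic_set I S" unfolding algebraic_set_def by blast
  have poly: "\<exists>p\<in>polynomial_maps I. \<forall>x\<in>A. neg x j = p x" if "j \<in> I" for j A
  proof (rule bexI[of _ "\<lambda>x. neg x j"])
    show "(\<lambda>x. neg x j) \<in> polynomial_maps I"
      unfolding neg_def by (rule polynomial_maps_uminus_comp[OF polynomial_maps.coordinate[OF that]])
  qed simp
  have "regular_map I S I T neg" "regular_map I T I S neg"
    unfolding regular_map_def using ST poly by simp_all
  moreover have "\<forall>x\<in>S. neg (neg x) = x" "\<forall>x\<in>T. neg (neg x) = x" using S inv unfolding F(2) by blast+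
  ultimately show ?thesis unfolding algebraic_isomorphism_def using algS T by blast
qed

section \<open>The equations\<close>

lemma pair_val_diag: "pair_val x i i = 2" and pair_val_sym: "pair_val x i j = pair_val x j i"
  by (auto simp: pair_val_def min.commute max.commute)

lemma GH_iff: "GH n x \<longleftrightarrow> minors_factor n (pair_val x) (\<lambda>i j k. x (Triple_coord i j k))"
  unfolding GH_def minors_factor_def det_minor3 ..

lemma wirtinger_triples_range:
  assumes D: "knot_diagram n D" and t: "(i, j, k) \<in> wirtinger_triples n D"
  shows "i \<in> {1..n}" "j \<in> {1..n}" "k \<in> {1..n}"
proof -
  obtain c where c: "c \<in> {1..n}" "i = arc_into D (Over c)"
    "j = min (arc_into D (Under c)) c" "k = max (arc_into D (Under c)) c"
    using t unfolding wirtinger_triples_def by blast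
  then show "i \<in> {1..n}" "j \<in> {1..n}" "k \<in> {1..n}"
    using arc_into_range[OF D, of "Over c"] arc_into_range[OF D, of "Under c"]
    by (simp_all add: min_def max_def)
qed

lemma pair_val_polynomial:
  assumes "i \<in> {1..n}" "j \<in> {1..n}"
  shows "(\<lambda>x. pair_val x i j) \<in> polynomial_maps (coords n)"
proof (cases "i = j")
  case False
  then have "Pair_coord (min i j) (max i j) \<in> coords n"
    using assms by (auto simp: coords_def min_def max_def)
  then show ?thesis using False by (simp add: pair_val_def polynomial_maps.coordinate)
qed (simp add: pair_val_def polynomial_maps.const)

lemma algebraic_F2_GH_set:
  assumes D: "knot_diagram n D"
  shows "algebraic_set (coords n) (F2_GH_set n D)"
proof -
  define A where "A = (\<lambda>(a, i, j, k) x. pair_val x a k - (pair_val x i j * pair_val x a i - pair_val x a j)) `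
    ({1..n} \<times> wirtinger_triples n D)"
  define T where "T = {(i, j, k). 1 \<le> i \<and> i < j \<and> j < k \<and> k \<le> n}"
  define B where "B = (\<lambda>((i, j, k), (i', j', k')) x. x (Triple_coord i j k) * x (Triple_coord i' j' k') -
    1 / 2 * minor3 (pair_val x) i j k i' j' k') ` (T \<times> T)"
  have "A \<subseteq> polynomial_maps (coords n)"
    unfolding A_def
  proof (rule image_subsetI)
    fix q assume "q \<in> {1..n} \<times> wirtinger_triples n D"
    then obtain a i j k where a: "a \<in> {1..n}" and t: "(i, j, k) \<in> wirtinger_triples n D" and q: "q = (a, i, j, k)"
      by (cases q) blast
    show "(\<lambda>(a, i, j, k) x. pair_val x a k - (pair_val x i j * pair_val x a i - pair_val x a j)) q
        \<in> polynomial_maps (coords n)"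
      unfolding q prod.case
      by (intro polynomial_intros pair_val_polynomial a wirtinger_triples_range[OF D t])
  qed
  moreover have "B \<subseteq> polynomial_maps (coords n)"
  proof -
    have "(\<lambda>x. x (Triple_coord i j k) * x (Triple_coord i' j' k') -
      1 / 2 * minor3 (pair_val x) i j k i' j' k') \<in> polynomial_maps (coords n)"
      if "(i, j, k) \<in> T" "(i', j', k') \<in> T" for i j k i' j' k'
      unfolding minor3_def
      by (intro polynomial_intros pair_val_polynomial)
        (use that in \<open>auto simp: T_def coords_def\<close>)
    then show ?thesis by (auto simp: B_def)
  qed
  moreover have "F2 n D x \<longleftrightarrow> (\<forall>f\<in>A. f x = 0)" for x
    by (force simp: F2_def A_def)
  moreover have "GH n x \<longleftrightarrow> (\<forall>f\<in>B. f x = 0)" for x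
    by (auto simp: GH_iff minors_factor_def B_def T_def)
  ultimately show ?thesis
    unfolding algebraic_set_def F2_GH_set_def by (intro exI[of _ "A \<union> B"]) auto
qed

text \<open>Triples order the underarcs by number, relators by the orientation of the knot;
  \<open>half_turn_sym\<close> mediates.\<close>

lemma wirtinger_triples_half_turn:
  assumes unit: "\<And>a. a \<in> {1..n} \<Longrightarrow> form (v a) (v a) = 2" and D: "knot_diagram n D"
  shows "(\<forall>(i, j, k)\<in>wirtinger_triples n D. v k = form (v i) (v j) *s v i - v j) \<longleftrightarrow>
    (\<forall>c\<in>{1..n}. let i = arc_into D (Over c); j = arc_into D (Under c)
      in v c = form (v i) (v j) *s v i - v j)"
proof -
  define i j where "i c = arc_into D (Over c)" and "j c = arc_into D (Under c)" for c
  have swap: "v (max (j c) c) = form (v (i c)) (v (min (j c) c)) *s v (i c) - v (min (j c) c) \<longleftrightarrow>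
      v c = form (v (i c)) (v (j c)) *s v (i c) - v (j c)" for c
    using half_turn_sym[OF unit[of "i c"], of "v c" "v (j c)"] arc_into_range[OF D]
    by (simp add: i_def min_def max_def)
  have "(\<forall>(i, j, k)\<in>wirtinger_triples n D. v k = form (v i) (v j) *s v i - v j) \<longleftrightarrow>
    (\<forall>c\<in>{1..n}. v (max (j c) c) = form (v (i c)) (v (min (j c) c)) *s v (i c) - v (min (j c) c))"
    (is "?L \<longleftrightarrow> ?R")
  proof
    assume L: ?L
    show ?R
    proof
      fix c assume "c \<in> {1..n}"
      then have "(i c, min (j c) c, max (j c) c) \<in> wirtinger_triples n D"
        unfolding wirtinger_triples_def i_def j_def by blast
      from bspec[OF L this]
      show "v (max (j c) c) = form (v (i c)) (v (min (j c) c)) *s v (i c) - v (min (j c) c)"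
        by (simp only: prod.case)
    qed
  next
    assume R: ?R
    show ?L
    proof
      fix t assume "t \<in> wirtinger_triples n D"
      then obtain c where c: "c \<in> {1..n}" and t: "t = (i c, min (j c) c, max (j c) c)"
        unfolding wirtinger_triples_def i_def j_def by blast
      show "case t of (i, j, k) \<Rightarrow> v k = form (v i) (v j) *s v i - v j"
        unfolding t prod.case using bspec[OF R c] .
    qed
  qed
  then show ?thesis unfolding swap unfolding i_def j_def Let_def .
qed

section \<open>The trace-free slice\<close>

lemma trace_point_sl:
  assumes \<rho>: "\<rho> \<in> hom G SL2" and G: "group G" and m: "m \<in> {1..n} \<rightarrow> carrier G"
    and v: "\<And>i. i \<in> {1..n} \<Longrightarrow> \<rho> (m i) = sl (v i)"
  shows "1 \<le> i \<Longrightarrow> i < j \<Longrightarrow> j \<le> n \<Longrightarrow> trace_point n G m \<rho> (Pair_coord i j) = - form (v i) (v j)"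
    and "1 \<le> i \<Longrightarrow> i < j \<Longrightarrow> j < k \<Longrightarrow> k \<le> n \<Longrightarrow>
      trace_point n G m \<rho> (Triple_coord i j k) = volume (v i) (v j) (v k)"
proof -
  interpret group G by (rule G)
  have cl: "m i \<in> carrier G" if "i \<in> {1..n}" for i using m that by auto
  have mult: "\<rho> (x \<otimes>\<^bsub>G\<^esub> y) = \<rho> x ** \<rho> y" if "x \<in> carrier G" "y \<in> carrier G" for x y
    using hom_mult[OF \<rho> that] by simp
  show "trace_point n G m \<rho> (Pair_coord i j) = - form (v i) (v j)" if "1 \<le> i" "i < j" "j \<le> n"
    using that by (simp add: trace_point_def coords_def mult cl v trace_sl2)
  show "trace_point n G m \<rho> (Triple_coord i j k) = volume (v i) (v j) (v k)"
    if "1 \<le> i" "i < j" "j < k" "k \<le> n"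
    using that by (simp add: trace_point_def coords_def mult cl v trace_sl3)
qed

lemma meridians_carrier:
  assumes h: "tubular_neighbourhood h K" and "\<mu> \<in> meridians h e"
  shows "\<mu> \<in> carrier (knot_group h e)"
proof -
  obtain d z s where \<mu>: "\<mu> = path_class (knot_exterior h) (meridian_loop h d z s)" "path d"
    "path_image d \<subseteq> knot_exterior h" "pathstart d = e" "pathfinish d = h (z, 1)" "z \<in> S1" "s = 1 \<or> s = -1"
    using assms(2) unfolding meridians_def meridian_loop_def by blast
  then show ?thesis using path_class_carrier[OF meridian_loop_is_loop[OF h \<mu>(2-7)]] by simp
qed

text \<open>Every meridian is conjugate to \<open>\<nu>\<close> or to its inverse, and both
  operations preserve the trace in \<open>SL2\<close>.\<close>

lemma trace_free_if_one:
  assumes h: "tubular_neighbourhood h K" and \<rho>: "\<rho> \<in> hom (knot_group h e) SL2"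
    and e: "e \<in> knot_exterior h"
    and \<nu>: "\<nu> \<in> meridians h e" "trace (\<rho> \<nu>) = 0"
  shows "trace_free h e \<rho>"
  unfolding trace_free_def
proof
  let ?G = "knot_group h e"
  interpret group_hom ?G SL2 \<rho>
    using \<rho> fundamental_group_group[OF e] SL2_group by (simp add: group_hom_def group_hom_axioms_def)
  fix \<mu> assume \<mu>: "\<mu> \<in> meridians h e"
  obtain c \<nu>' where c: "c \<in> carrier ?G" "\<nu>' \<in> carrier ?G" "\<mu> \<otimes>\<^bsub>?G\<^esub> c = c \<otimes>\<^bsub>?G\<^esub> \<nu>'"
    "\<nu>' = \<nu> \<or> \<nu>' \<otimes>\<^bsub>?G\<^esub> \<nu> = \<one>\<^bsub>?G\<^esub>"
    by (rule meridians_conjugate[OF h \<mu> \<nu>(1)])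
  have cl: "\<mu> \<in> carrier ?G" "\<nu> \<in> carrier ?G" using meridians_carrier[OF h] \<mu> \<nu> by auto
  have det: "det (\<rho> x) = 1" if "x \<in> carrier ?G" for x using hom_closed[OF that] by simp
  have "\<rho> \<mu> ** \<rho> c = \<rho> c ** \<rho> \<nu>'"
    using hom_mult[of \<mu> c] hom_mult[of c \<nu>'] c cl by simp
  then have "trace (\<rho> \<mu>) = trace (\<rho> \<nu>')" using det c by (intro trace_conjugate_SL2) auto
  moreover have "trace (\<rho> \<nu>') = trace (\<rho> \<nu>)"
  proof (cases "\<nu>' = \<nu>")
    case False
    then have "\<nu>' \<otimes>\<^bsub>?G\<^esub> \<nu> = \<one>\<^bsub>?G\<^esub>" using c by blast
    then have "\<rho> \<nu>' ** \<rho> \<nu> = mat 1" using hom_mult[of \<nu>' \<nu>] hom_one c cl by simp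
    then show ?thesis using det cl by (intro trace_inverse_SL2) auto
  qed simp
  ultimately show "trace (\<rho> \<mu>) = 0" using \<nu> by simp
qed

lemma trace_point_in_F2_GH_set:
  assumes D: "knot_diagram n D" and G: "group G" and c0: "c0 \<in> {1..n}"
    and P: "presents G {1..n} m (wirtinger_relator D ` ({1..n} - {c0}))"
    and \<rho>: "\<rho> \<in> hom G SL2" and tf: "\<And>i. i \<in> {1..n} \<Longrightarrow> trace (\<rho> (m i)) = 0"
  shows "(\<lambda>c\<in>coords n. - trace_point n G m \<rho> c) \<in> F2_GH_set n D"
proof -
  interpret SL2: group SL2 by (rule SL2_group)
  have m: "m \<in> {1..n} \<rightarrow> carrier G" and R: "wirtinger_relator D ` ({1..n} - {c0}) \<subseteq> lists ({1..n} \<times> UNIV)"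
    using P unfolding presents_def by blast+
  have "\<forall>i\<in>{1..n}. \<exists>v. \<rho> (m i) = sl v" using tf trace_free_eq_sl by blast
  then obtain v where v: "\<And>i. i \<in> {1..n} \<Longrightarrow> \<rho> (m i) = sl (v i)" by metis
  have \<rho>m: "\<rho> \<circ> m \<in> {1..n} \<rightarrow> carrier SL2" using \<rho> m hom_in_carrier by fastforce
  have unit: "form (v i) (v i) = 2" if "i \<in> {1..n}" for i
    using funcset_mem[OF \<rho>m that] v[OF that] by (simp add: det_sl)
  have "eval_word SL2 (\<rho> \<circ> m) (wirtinger_relator D c) = \<one>\<^bsub>SL2\<^esub>" if "c \<in> {1..n} - {c0}" for c
  proof -
    have "eval_word G m (wirtinger_relator D c) = \<one>\<^bsub>G\<^esub>" using that by (intro presents_relator[OF P]) simp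
    moreover have "wirtinger_relator D c \<in> lists ({1..n} \<times> UNIV)" using R that by blast
    then have "\<rho> (eval_word G m (wirtinger_relator D c)) = eval_word SL2 (\<rho> \<circ> m) (wirtinger_relator D c)"
      by (rule hom_eval_word[OF G SL2_group \<rho> m])
    ultimately show ?thesis using hom_one[OF \<rho> G SL2_group] by simp
  qed
  \<comment> \<open>(F2) also ranges over \<open>c0\<close>, whose relator the presentation
    omits.\<close>
  then have all: "eval_word SL2 (\<rho> \<circ> m) (wirtinger_relator D c) = \<one>\<^bsub>SL2\<^esub>" if "c \<in> {1..n}" for c
    using SL2.wirtinger_relator_redundant[OF D \<rho>m c0] that by (cases "c = c0") auto
  have "v c = form (v (arc_into D (Over c))) (v (arc_into D (Under c))) *s v (arc_into D (Over c))
      - v (arc_into D (Under c))" if "c \<in> {1..n}" for c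
    using wirtinger_relator_SL2[OF D that, of v "\<rho> \<circ> m"] unit v all[OF that] by simp
  then have half: "\<forall>(i, j, k)\<in>wirtinger_triples n D. v k = form (v i) (v j) *s v i - v j"
    using wirtinger_triples_half_turn[of n v D] unit D by (simp add: Let_def)
  define x where "x = (\<lambda>c\<in>coords n. - trace_point n G m \<rho> c)"
  have pv: "pair_val x i j = form (v i) (v j)" if ij: "i \<in> {1..n}" "j \<in> {1..n}" for i j
  proof (cases i j rule: linorder_cases)
    case less
    then have "Pair_coord i j \<in> coords n" using ij by (auto simp: coords_def)
    then show ?thesis using less ij trace_point_sl(1)[OF \<rho> G m v] by (simp add: pair_val_def x_def)
  next
    case equal
    then show ?thesis using unit ij by (simp add: pair_val_def)
  next
    case greater
    then have "Pair_coord j i \<in> coords n" using ij by (auto simp: coords_def)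
    then show ?thesis using greater ij trace_point_sl(1)[OF \<rho> G m v] form_sym[of "v i" "v j"]
      by (simp add: pair_val_def x_def)
  qed
  have tv: "x (Triple_coord i j k) = - volume (v i) (v j) (v k)" if "1 \<le> i" "i < j" "j < k" "k \<le> n" for i j k
  proof -
    have "Triple_coord i j k \<in> coords n" using that by (auto simp: coords_def)
    then show ?thesis using trace_point_sl(2)[OF \<rho> G m v that] by (simp add: x_def)
  qed
  have "F2 n D x"
    unfolding F2_def
  proof (clarify)
    fix a i j k assume a: "a \<in> {1..n}" and t: "(i, j, k) \<in> wirtinger_triples n D"
    have diff: "form u (w - w') = form u w - form u w'" for u w w' by (simp add: form_def algebra_simps)
    note r = wirtinger_triples_range[OF D t]
    have "v k = form (v i) (v j) *s v i - v j" using half t by blast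
    then show "pair_val x a k = pair_val x i j * pair_val x a i - pair_val x a j"
      using a r by (simp only: pv diff form_linear)
  qed
  moreover have "GH n x"
    unfolding GH_iff minors_factor_def
  proof (intro allI impI, elim conjE)
    fix i j k i' j' k' assume I: "1 \<le> i" "i < j" "j < k" "k \<le> n" "1 \<le> i'" "i' < j'" "j' < k'" "k' \<le> n"
    have "minor3 (pair_val x) i j k i' j' k' = minor3 (\<lambda>a b. form (v a) (v b)) i j k i' j' k'"
      using I by (simp add: minor3_def pv)
    then show "x (Triple_coord i j k) * x (Triple_coord i' j' k') = 1 / 2 * minor3 (pair_val x) i j k i' j' k'"
      using volume_mult[of v i j k v i' j' k'] tv I by simp
  qed
  ultimately have "x \<in> F2_GH_set n D" by (simp add: F2_GH_set_def x_def)
  then show ?thesis by (simp add: x_def)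
qed

lemma F2_GH_set_realized:
  assumes D: "knot_diagram n D" and G: "group G"
    and P: "presents G {1..n} m (wirtinger_relator D ` ({1..n} - {c0}))"
    and x: "x \<in> F2_GH_set n D"
  obtains \<rho> where "\<rho> \<in> hom G SL2" "\<And>i. i \<in> {1..n} \<Longrightarrow> trace (\<rho> (m i)) = 0"
    "(\<lambda>c\<in>coords n. - x c) = trace_point n G m \<rho>"
proof -
  have n: "n \<ge> 1" using D by (simp add: knot_diagram_def)
  have m: "m \<in> {1..n} \<rightarrow> carrier G" using P unfolding presents_def by blast
  have F2: "F2 n D x" and GH: "minors_factor n (pair_val x) (\<lambda>i j k. x (Triple_coord i j k))"
    using x by (auto simp: F2_GH_set_def GH_iff)
  obtain v where form: "\<And>a b. a \<in> {1..n} \<Longrightarrow> b \<in> {1..n} \<Longrightarrow> form (v a) (v b) = pair_val x a b"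
    and vol: "\<And>i j k. 1 \<le> i \<Longrightarrow> i < j \<Longrightarrow> j < k \<Longrightarrow> k \<le> n \<Longrightarrow>
      volume (v i) (v j) (v k) = - x (Triple_coord i j k)"
    and lin: "\<And>i j k s. \<forall>a\<in>{1..n}. pair_val x a k = s * pair_val x a i - pair_val x a j \<Longrightarrow>
      v k = s *s v i - v j"
    by (rule gram_vectors_oriented[OF n pair_val_diag pair_val_sym GH]) (rule that; assumption)
  have unit: "form (v a) (v a) = 2" if "a \<in> {1..n}" for a using form that by (simp add: pair_val_diag)
  have "v k = form (v i) (v j) *s v i - v j" if t: "(i, j, k) \<in> wirtinger_triples n D" for i j k
  proof -
    \<comment> \<open>For a fixed crossing and varying \<open>a\<close>, (F2) is a linear relation
      between columns of the Gram matrix, which \<open>lin\<close> lifts to the vectors.\<close>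
    have "\<forall>a\<in>{1..n}. pair_val x a k = pair_val x i j * pair_val x a i - pair_val x a j"
      using F2 t unfolding F2_def by blast
    then show ?thesis using lin form wirtinger_triples_range[OF D t] by simp
  qed
  then have half: "v c = form (v (arc_into D (Over c))) (v (arc_into D (Under c))) *s v (arc_into D (Over c))
      - v (arc_into D (Under c))" if "c \<in> {1..n}" for c
    using wirtinger_triples_half_turn[of n v D] unit D that by (auto simp: Let_def)
  have "(\<lambda>i. sl (v i)) \<in> {1..n} \<rightarrow> carrier SL2" using unit by (auto simp: det_sl)
  moreover have "eval_word SL2 (\<lambda>i. sl (v i)) r = \<one>\<^bsub>SL2\<^esub>"
    if "r \<in> wirtinger_relator D ` ({1..n} - {c0})" for r
    using that wirtinger_relator_SL2[OF D, of _ v "\<lambda>i. sl (v i)"] unit half by auto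
  ultimately obtain \<rho> where \<rho>: "\<rho> \<in> hom G SL2" "\<And>i. i \<in> {1..n} \<Longrightarrow> \<rho> (m i) = sl (v i)"
    using presents_hom[OF G SL2_group P] by blast
  have "(\<lambda>c\<in>coords n. - x c) = trace_point n G m \<rho>"
  proof
    fix c
    show "(\<lambda>c\<in>coords n. - x c) c = trace_point n G m \<rho> c"
    proof (cases "c \<in> coords n")
      case True
      then consider i j where "c = Pair_coord i j" "1 \<le> i" "i < j" "j \<le> n"
        | i j k where "c = Triple_coord i j k" "1 \<le> i" "i < j" "j < k" "k \<le> n"
        by (auto simp: coords_def)
      then show ?thesis
      proof cases
        case 1
        then show ?thesis using True trace_point_sl(1)[OF \<rho>(1) G m \<rho>(2) 1(2-4)] form[of i j]
          by (simp add: pair_val_def)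
      next
        case 2
        then show ?thesis using True trace_point_sl(2)[OF \<rho>(1) G m \<rho>(2) 2(2-5)] vol[OF 2(2-5)] by simp
      qed
    qed (simp add: trace_point_def)
  qed
  moreover have "trace (\<rho> (m i)) = 0" if "i \<in> {1..n}" for i using \<rho>(2)[OF that] by (simp add: trace_sl)
  ultimately show ?thesis using that \<rho>(1) by blast
qed

theorem theorem2p1:
  fixes K :: "((real^3) \<times> real) set"
    and h :: "complex \<times> complex \<Rightarrow> (real^3) \<times> real"
    and e :: "(real^3) \<times> real"
    and D :: diagram
    and n c0 :: nat
    and m :: "nat \<Rightarrow> (real \<Rightarrow> (real^3) \<times> real) set"
  assumes knot: "tubular_neighbourhood h K"
    and base_point: "e \<in> knot_exterior h"
    and diagram: "knot_diagram n D" "diagram_of D K"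
    and meridians: "\<And>i. i \<in> {1..n} \<Longrightarrow> m i \<in> meridians h e"
    and omitted_crossing: "c0 \<in> {1..n}"
    and wirtinger_presentation:
      "presents (knot_group h e) {1..n} m (wirtinger_relator D ` ({1..n} - {c0}))"
  shows "algebraic_isomorphism
           (coords n) (trace_free_slice h e n m)
           (coords n) (F2_GH_set n D)
           (\<lambda>x. \<lambda>c\<in>coords n. - x c)"
proof (rule algebraic_isomorphism_uminus)
  let ?G = "knot_group h e"
  note D = diagram(1) and P = wirtinger_presentation
  have G: "group ?G" by (rule fundamental_group_group[OF base_point])
  show "algebraic_set (coords n) (F2_GH_set n D)" by (rule algebraic_F2_GH_set[OF D])
  show "trace_free_slice h e n m \<subseteq> coords n \<rightarrow>\<^sub>E UNIV"
    by (auto simp: trace_free_slice_def trace_point_def)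
  show "(\<lambda>x. \<lambda>c\<in>coords n. - x c) \<in> trace_free_slice h e n m \<rightarrow> F2_GH_set n D"
  proof
    fix x assume "x \<in> trace_free_slice h e n m"
    then obtain \<rho> where \<rho>: "x = trace_point n ?G m \<rho>" "\<rho> \<in> hom ?G SL2" "trace_free h e \<rho>"
      unfolding trace_free_slice_def by blast
    have "trace (\<rho> (m i)) = 0" if "i \<in> {1..n}" for i
      using \<rho>(3) meridians[OF that] by (simp add: trace_free_def)
    then show "(\<lambda>c\<in>coords n. - x c) \<in> F2_GH_set n D"
      unfolding \<rho>(1) by (rule trace_point_in_F2_GH_set[OF D G omitted_crossing P \<rho>(2)])
  qed
  show "(\<lambda>x. \<lambda>c\<in>coords n. - x c) \<in> F2_GH_set n D \<rightarrow> trace_free_slice h e n m"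
  proof
    fix x assume x: "x \<in> F2_GH_set n D"
    obtain \<rho> where \<rho>: "\<rho> \<in> hom ?G SL2" "\<And>i. i \<in> {1..n} \<Longrightarrow> trace (\<rho> (m i)) = 0"
      "(\<lambda>c\<in>coords n. - x c) = trace_point n ?G m \<rho>"
      by (rule F2_GH_set_realized[OF D G P x]) (rule that; assumption)
    \<comment> \<open>One generator of trace 0 is enough; \<open>c0\<close> supplies an
      index.\<close>
    have "trace_free h e \<rho>"
      by (rule trace_free_if_one[OF knot \<rho>(1) base_point meridians \<rho>(2)]; fact omitted_crossing)
    then show "(\<lambda>c\<in>coords n. - x c) \<in> trace_free_slice h e n m"
      using \<rho>(1,3) unfolding trace_free_slice_def by blast
  qed
qed

end
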